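(* Let $\gamma\in\mathbb{R}$. For any $m\geq-\frac12$ the boundary value problem $$f'''+(m+2)ff''-(2m+1)f'^2=0 \text{ on } [0,\infty),\qquad f(0)=-\gamma,\quad f''(0)=-1,\quad f'(\infty)=0$$ admits one and only one concave solution $f$. This solution is positive at infinity and satisfies $$\forall t\geq 0,\quad -\gamma\leq f(t)\leq\sqrt{\gamma^2+2\frac{f'(0)}{m+2}}.$$
   Context: Here $f'(\infty):=\lim_{t\to\infty}f'(t)$. A solution is a three times differentiable function $f:[0,\infty)\to\mathbb{R}$ satisfying the differential equation on $[0,\infty)$ together with all three boundary conditions; $f'(0)$ is not prescribed. "Concave" means concave on $[0,\infty)$; "positive at infinity" means $f(t)>0$ for all sufficiently large $t$. *)

theory Defs
  imports "HOL-Analysis.Analysis"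
begin

text \<open>
  Functions on the half-line are represented by total functions on the reals of which only
  the values on \<open>{0..}\<close> matter. The derivative is therefore taken within \<open>{0..}\<close>,
  i.e. it is one-sided at \<open>0\<close>.
\<close>

definition hderiv :: "(real \<Rightarrow> real) \<Rightarrow> real \<Rightarrow> real" where
  "hderiv f t = vector_derivative f (at t within {0..})"

definition three_times_differentiable :: "(real \<Rightarrow> real) \<Rightarrow> bool" where
  "three_times_differentiable f \<longleftrightarrow>
     f differentiable_on {0..} \<and>
     hderiv f differentiable_on {0..} \<and>
     hderiv (hderiv f) differentiable_on {0..}"

definition bvp_solution :: "real \<Rightarrow> real \<Rightarrow> (real \<Rightarrow> real) \<Rightarrow> bool" where
  "bvp_solution m \<gamma> f \<longleftrightarrow>
     three_times_differentiable f \<and>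
     (\<forall>t\<ge>0. hderiv (hderiv (hderiv f)) t + (m + 2) * f t * hderiv (hderiv f) t
              - (2 * m + 1) * (hderiv f t)\<^sup>2 = 0) \<and>
     f 0 = - \<gamma> \<and>
     hderiv (hderiv f) 0 = - 1 \<and>
     (hderiv f \<longlongrightarrow> 0) at_top"

end

theory Submission
  imports Defs
begin

text \<open>
  Write \<open>a = m + 2\<close>, \<open>b = 2 * m + 1\<close>, \<open>p = f'\<close>, \<open>r = f''\<close>. The quantity \<open>H = f'' + a f f'\<close> satisfies
  \<open>H' = (a + b) f'\<^sup>2 \<ge> 0\<close>, and \<open>W = f' + (a / 2) f\<^sup>2\<close> satisfies \<open>W' = H\<close>.

  Existence is by shooting in \<open>\<alpha> = f'(0)\<close>. The slopes for which \<open>f'\<close> becomes negative and those for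
  which \<open>H\<close> becomes positive form two disjoint, nonempty, open sets of \<open>\<alpha>\<close>, so some \<open>\<alpha>\<close> lies in neither;
  then \<open>f' \<ge> 0\<close> and \<open>H \<le> 0\<close> throughout. This forces concavity and \<open>f' \<longrightarrow> 0\<close>, and the bound on \<open>f\<close>
  is the monotonicity of \<open>W\<close>. To have global solutions for all \<open>\<alpha>\<close>, the system in \<open>(f, W, H)\<close> is
  truncated to a Lipschitz one; on the surviving trajectory the truncation is inactive because
  \<open>W \<le> W(0)\<close> and \<open>f' \<ge> 0\<close> bound \<open>f\<close> and \<open>f'\<close>.

  If \<open>f\<close> never became positive, then \<open>ln (-H) - k ln (-f)\<close> with \<open>k = (a + b) / a\<close> would be
  nondecreasing, while \<open>-H \<le> (a + b) (-f) f'\<close> and \<open>f' \<le> (b / 2) f\<^sup>2\<close> drive it to \<open>-\<infinity>\<close>, because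
  \<open>k < 3\<close>.

  For uniqueness, the gap \<open>f' - g'\<close> of two concave solutions with \<open>f'(0) > g'(0)\<close> is nondecreasing,
  so they cannot both have slope \<open>0\<close> at infinity; equal initial slopes are handled by Gronwall.
\<close>

section \<open>Global flows of Lipschitz vector fields\<close>

lemma halfline_antiderivative:
  fixes g :: "real \<Rightarrow> 'a::banach"
  assumes "continuous_on {0..} g" "0 \<le> t"
  shows "((\<lambda>u. integral {0..u} g) has_vector_derivative g t) (at t within {0..})"
proof -
  have "continuous_on {0..t+1} g" using assms(1) by (rule continuous_on_subset) auto
  then have "((\<lambda>u. integral {0..u} g) has_vector_derivative g t) (at t within {0..t+1})"
    using integral_has_vector_derivative[of 0 "t+1" g t] assms(2) by auto
  moreover have "at t within {0..t+1} = at t within {0..}"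
    by (rule at_within_nhd[of _ "{..<t+1}"]) auto
  ultimately show ?thesis by simp
qed

text \<open>\<open>max 0 t\<close> extends the integral constantly to negative times, because the
  Picard operator is set up on bounded continuous functions on the whole line.\<close>

lemma halfline_integral_continuous:
  fixes g :: "real \<Rightarrow> 'a::banach"
  assumes "continuous_on {0..} g"
  shows "continuous_on UNIV (\<lambda>t. integral {0..max 0 t} g)"
proof -
  have 1: "continuous_on {0..} (\<lambda>u. integral {0..u} g)"
    using halfline_antiderivative[OF assms] 
    by (meson atLeast_iff continuous_on_vector_derivative)
  have 2: "continuous_on UNIV (\<lambda>t::real. max 0 t)" by (intro continuous_intros)
  show ?thesis by (rule continuous_on_compose2[OF 1 2]) auto
qed

text \<open>The bound on \<open>g\<close> integrates to at most
  \<open>C / (2 * L) * exp (2 * L * t)\<close>, and the weight cancels the exponential. The rate is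
  2 L so that C = L d yields d / 2, the contraction factor.\<close>

lemma weighted_integral_bound:
  fixes g :: "real \<Rightarrow> 'a::banach"
  assumes g: "continuous_on {0..} g" and L: "0 < L" and t: "0 \<le> t" and C: "0 \<le> C"
    and b: "\<And>s. 0 \<le> s \<Longrightarrow> norm (g s) \<le> C * exp (2 * L * s)"
  shows "norm (exp (- (2 * L * t)) *\<^sub>R integral {0..t} g) \<le> C / (2 * L)"
proof -
  have "((\<lambda>s. C * exp (2 * L * s)) has_integral
      (C / (2 * L) * exp (2 * L * t) - C/(2 * L) * exp (2 * L * 0))) {0..t}"
    by (rule fundamental_theorem_of_calculus)
      (use t L in \<open>auto intro!: derivative_eq_intros simp flip: has_real_derivative_iff_has_vector_derivative\<close>)
  then have I: "(\<lambda>s. C * exp (2 * L * s)) integrable_on {0..t}"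
    and e: "integral {0..t} (\<lambda>s. C * exp (2 * L * s)) = C / (2 * L) * exp (2 * L * t) - C/(2 * L)"
    by (auto simp: has_integral_iff)
  have "norm (integral {0..t} g) \<le> integral {0..t} (\<lambda>s. C * exp (2 * L * s))"
    by (rule integral_norm_bound_integral[OF _ I])
      (use b in \<open>auto intro!: integrable_continuous_real continuous_on_subset[OF g]\<close>)
  also have "\<dots> \<le> C/(2 * L) * exp (2 * L * t)" using e C L by simp
  finally have "exp (- (2 * L * t)) * norm (integral {0..t} g) \<le> exp (- (2 * L * t)) * (C/(2 * L) * exp (2 * L * t))"
    by (intro mult_left_mono) auto
  also have "\<dots> = C/(2 * L)" by (simp add: exp_minus)
  finally show ?thesis by simp
qed

text \<open>
  With the weight \<open>exp (- 2 L t)\<close> the Picard operator halves distances in the sup norm on the whole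
  half-line, so no local solutions have to be glued together.
\<close>
lemma lipschitz_flow:
  fixes F :: "'a::banach \<Rightarrow> 'a"
  assumes L: "0 < L" and F: "\<And>x y. norm (F x - F y) \<le> L * norm (x - y)"
  obtains Y :: "'a \<Rightarrow> real \<Rightarrow> 'a"
  where "\<And>x. Y x 0 = x"
    and "\<And>x t. 0 \<le> t \<Longrightarrow> (Y x has_vector_derivative F (Y x t)) (at t within {0..})"
    and "\<And>t. 0 \<le> t \<Longrightarrow> continuous_on UNIV (\<lambda>x. Y x t)"
proof -
  have contF: "continuous_on UNIV F"
    unfolding continuous_on_iff
  proof (intro ballI allI impI)
    fix x e :: _ assume "(0::real) < e"
    then show "\<exists>d>0. \<forall>x'\<in>UNIV. dist x' x < d \<longrightarrow> dist (F x') (F x) < e"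
      using L F[of _ x] by (intro exI[of _ "e/L"])
        (auto simp: dist_norm field_simps intro: le_less_trans)
  qed
  \<comment> \<open>\<open>u\<close> is the weighted unknown; multiplying it by
    \<open>exp (2 * L * s)\<close> recovers the trajectory.\<close>
  define G where "G u s = F (exp (2 * L * s) *\<^sub>R apply_bcontfun u s)" for u :: "real \<Rightarrow>\<^sub>C 'a" and s
  have contG: "continuous_on S (G u)" for u S
    unfolding G_def by (rule continuous_on_compose2[OF contF]) (auto intro!: continuous_intros)
  define \<Phi> where "\<Phi> x u t = exp (- (2 * L *  max 0 t)) *\<^sub>R (x + integral {0..max 0 t} (G u))"
    for x u t
  have bcont: "\<Phi> x u \<in> bcontfun" for x u
  proof (rule bcontfun_normI)
    show "continuous_on UNIV (\<Phi> x u)"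
      unfolding \<Phi>_def by (intro continuous_intros halfline_integral_continuous contG)
    fix t
    let ?C = "norm (F 0) + L * norm u"
    have gb: "norm (G u s) \<le> ?C * exp (2 * L * s)" if "0 \<le> s" for s
    proof -
      have "norm (G u s) \<le> norm (F 0) + norm (G u s - F 0)" by (metis add.commute diff_add_cancel norm_triangle_ineq)
      also have "norm (G u s - F 0) \<le> L * (exp (2 * L * s) * norm u)"
        using F[of "exp (2 * L * s) *\<^sub>R apply_bcontfun u s" 0] norm_bounded[of u s] L
        unfolding G_def by (auto elim!: order_trans)
      also have "norm (F 0) \<le> norm (F 0) * exp (2 * L * s)"
        using that L by (simp add: mult_le_cancel_left1)
      finally show ?thesis by (simp add: algebra_simps)
    qed
    have "norm (\<Phi> x u t) \<le> norm (exp (- (2 * L *  max 0 t)) *\<^sub>R x)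
        + norm (exp (- (2 * L *  max 0 t)) *\<^sub>R integral {0..max 0 t} (G u))"
      unfolding \<Phi>_def scaleR_add_right by (rule norm_triangle_ineq)
    also have "norm (exp (- (2 * L *  max 0 t)) *\<^sub>R x) \<le> norm x"
      using L by (simp add: mult_left_le_one_le)
    also have "norm (exp (- (2 * L *  max 0 t)) *\<^sub>R integral {0..max 0 t} (G u)) \<le> ?C / (2 * L)"
      by (rule weighted_integral_bound[OF contG L _ _ gb]) (use L in auto)
    finally show "norm (\<Phi> x u t) \<le> norm x + ?C / (2 * L)" by simp
  qed
  define T where "T x u = Bcontfun (\<Phi> x u)" for x u
  have T: "apply_bcontfun (T x u) = \<Phi> x u" for x u
    unfolding T_def by (rule Bcontfun_inverse[OF bcont])
  \<comment> \<open>The initial points may differ: \<open>x = z\<close> gives the contraction, and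
    at the fixed points the same estimate gives Lipschitz dependence on the initial point.\<close>
  have contr: "dist (T x u) (T z v) \<le> norm (x - z) + dist u v / 2" for x z u v
  proof (rule dist_bound)
    fix t
    let ?e = "exp (- (2 * L *  max 0 t))"
    have gb: "norm (G u s - G v s) \<le> (L * dist u v) * exp (2 * L * s)" for s
    proof -
      have "norm (G u s - G v s) \<le> L * norm (exp (2 * L * s) *\<^sub>R (apply_bcontfun u s - apply_bcontfun v s))"
        unfolding G_def using F by (metis scaleR_right_diff_distrib)
      also have "\<dots> = L * (exp (2 * L * s) * dist (apply_bcontfun u s) (apply_bcontfun v s))"
        by (simp add: dist_norm)
      also have "\<dots> \<le> L * (exp (2 * L * s) * dist u v)"
        using L dist_bounded[of u s v] by (intro mult_left_mono) auto
      finally show ?thesis by (simp add: mult_ac)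
    qed
    have "\<Phi> x u t - \<Phi> z v t = ?e *\<^sub>R (x - z) + ?e *\<^sub>R integral {0..max 0 t} (\<lambda>s. G u s - G v s)"
      unfolding \<Phi>_def
      by (subst integral_diff) (auto intro!: integrable_continuous_real contG simp: algebra_simps)
    then have "norm (\<Phi> x u t - \<Phi> z v t) \<le> norm (?e *\<^sub>R (x - z)) + norm (?e *\<^sub>R integral {0..max 0 t} (\<lambda>s. G u s - G v s))"
      by (metis norm_triangle_ineq)
    also have "norm (?e *\<^sub>R (x - z)) \<le> norm (x - z)"
      using L by (simp add: mult_left_le_one_le)
    also have "norm (?e *\<^sub>R integral {0..max 0 t} (\<lambda>s. G u s - G v s)) \<le> (L * dist u v) / (2 * L)"
      by (rule weighted_integral_bound[OF _ L _ _ gb]) (use L in \<open>auto intro!: continuous_intros contG\<close>)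
    finally show "dist (apply_bcontfun (T x u) t) (apply_bcontfun (T z v) t) \<le> norm (x - z) + dist u v / 2"
      using L by (simp add: T dist_norm)
  qed
  have "\<exists>u. T x u = u" for x
    using banach_fix_type[of "1/2" "T x"] contr[of x _ x] by auto
  then obtain U where U: "\<And>x. T x (U x) = U x" by metis
  define Y where "Y x t = exp (2 * L * t) *\<^sub>R apply_bcontfun (U x) t" for x t
  have Y: "Y x t = x + integral {0..t} (\<lambda>s. F (Y x s))" if "0 \<le> t" for x t
  proof -
    have "apply_bcontfun (U x) t = \<Phi> x (U x) t" by (metis T U)
    then have "Y x t = x + integral {0..t} (G (U x))"
      using that by (simp add: Y_def \<Phi>_def flip: exp_add)
    then show ?thesis by (simp add: G_def[abs_def] Y_def)
  qed
  show ?thesis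
  proof
    show "Y x 0 = x" for x using Y[of 0 x] by simp
    fix t :: real assume t: "0 \<le> t"
    show "(Y x has_vector_derivative F (Y x t)) (at t within {0..})" for x
    proof -
      have c: "continuous_on {0..} (\<lambda>s. F (Y x s))"
        unfolding Y_def by (rule continuous_on_compose2[OF contF]) (auto intro!: continuous_intros)
      have "((\<lambda>t. x + integral {0..t} (\<lambda>s. F (Y x s))) has_vector_derivative F (Y x t)) (at t within {0..})"
        by (rule derivative_eq_intros halfline_antiderivative[OF c t] refl)+ simp
      then show ?thesis
        by (rule has_vector_derivative_transform[rotated 2]) (use t Y in auto)
    qed
    have d: "dist (Y x t) (Y z t) \<le> exp (2 * L * t) * (2 * dist x z)" for x z
    proof -
      have "dist (U x) (U z) \<le> 2 * dist x z" using contr[of x "U x" z "U z"] by (simp add: U dist_norm)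
      then have "dist (apply_bcontfun (U x) t) (apply_bcontfun (U z) t) \<le> 2 * dist x z"
        using dist_bounded[of "U x" t "U z"] by linarith
      then show ?thesis by (simp add: Y_def dist_norm flip: scaleR_right_diff_distrib)
    qed
    show "continuous_on UNIV (\<lambda>x. Y x t)"
      unfolding continuous_on_iff
    proof (intro ballI allI impI)
      fix x e :: _ assume "(0::real) < e"
      then show "\<exists>d>0. \<forall>x'\<in>UNIV. dist x' x < d \<longrightarrow> dist (Y x' t) (Y x t) < e"
        using d[of _ x] by (intro exI[of _ "e/(2*exp (2 * L * t))"])
          (auto simp: field_simps intro: le_less_trans)
    qed
  qed
qed

section \<open>Monotonicity and growth on the half-line\<close>

lemma halfline_le:
  fixes F :: "real \<Rightarrow> real"
  assumes d: "\<And>x. 0 \<le> x \<Longrightarrow> (F has_real_derivative F' x) (at x within {0..})"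
    and nn: "\<And>x. s < x \<Longrightarrow> x < t \<Longrightarrow> 0 \<le> F' x" and st: "0 \<le> s" "s \<le> t"
  shows "F s \<le> F t"
proof (rule DERIV_nonneg_imp_increasing_open[OF st(2)])
  fix x assume x: "s < x" "x < t"
  then have "at x within {0..} = at x" using st by (intro at_within_interior) auto
  with d[of x] nn[of x] x st show "\<exists>y. DERIV F x :> y \<and> 0 \<le> y" by auto
next
  have "continuous_on {0..} F"
    by (rule DERIV_continuous_on) (use d in auto)
  then show "continuous_on {s..t} F" by (rule continuous_on_subset) (use st in auto)
qed

lemma halfline_ge:
  fixes F :: "real \<Rightarrow> real"
  assumes d: "\<And>x. 0 \<le> x \<Longrightarrow> (F has_real_derivative F' x) (at x within {0..})"
    and np: "\<And>x. s < x \<Longrightarrow> x < t \<Longrightarrow> F' x \<le> 0" and st: "0 \<le> s" "s \<le> t"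
  shows "F t \<le> F s"
  using halfline_le[of "\<lambda>x. - F x" "\<lambda>x. - F' x" s t] d np st
  by (auto intro!: derivative_intros)

lemma halfline_less:
  fixes F :: "real \<Rightarrow> real"
  assumes d: "\<And>x. 0 \<le> x \<Longrightarrow> (F has_real_derivative F' x) (at x within {0..})"
    and nn: "\<And>x. s < x \<Longrightarrow> x < t \<Longrightarrow> 0 < F' x" and st: "0 \<le> s" "s < t"
  shows "F s < F t"
proof (rule DERIV_pos_imp_increasing_open[OF st(2)])
  fix x assume x: "s < x" "x < t"
  then have "at x within {0..} = at x" using st by (intro at_within_interior) auto
  with d[of x] nn[of x] x st show "\<exists>y. DERIV F x :> y \<and> 0 < y" by auto
next
  have "continuous_on {0..} F"
    by (rule DERIV_continuous_on) (use d in auto)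
  then show "continuous_on {s..t} F" by (rule continuous_on_subset) (use st in auto)
qed

lemma halfline_growth_ge:
  fixes F :: "real \<Rightarrow> real"
  assumes d: "\<And>x. 0 \<le> x \<Longrightarrow> (F has_real_derivative F' x) (at x within {0..})"
    and c: "\<And>x. s < x \<Longrightarrow> x < t \<Longrightarrow> c \<le> F' x" and st: "0 \<le> s" "s \<le> t"
  shows "F s + c * (t - s) \<le> F t"
proof -
  have "F s - c * s \<le> F t - c * t"
  proof (rule halfline_le[where F = "\<lambda>x. F x - c * x" and F' = "\<lambda>x. F' x - c"])
    show "((\<lambda>x. F x - c * x) has_real_derivative F' x - c) (at x within {0..})" if "0 \<le> x" for x
      by (rule derivative_eq_intros d that refl)+ simp
  qed (use c st in auto)
  then show ?thesis by (simp add: algebra_simps)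
qed

lemma halfline_growth_le:
  fixes F :: "real \<Rightarrow> real"
  assumes d: "\<And>x. 0 \<le> x \<Longrightarrow> (F has_real_derivative F' x) (at x within {0..})"
    and c: "\<And>x. s < x \<Longrightarrow> x < t \<Longrightarrow> F' x \<le> c" and st: "0 \<le> s" "s \<le> t"
  shows "F t \<le> F s + c * (t - s)"
proof -
  have "F t - c * t \<le> F s - c * s"
  proof (rule halfline_ge[where F = "\<lambda>x. F x - c * x" and F' = "\<lambda>x. F' x - c"])
    show "((\<lambda>x. F x - c * x) has_real_derivative F' x - c) (at x within {0..})" if "0 \<le> x" for x
      by (rule derivative_eq_intros d that refl)+ simp
  qed (use c st in auto)
  then show ?thesis by (simp add: algebra_simps)
qed

lemma halfline_gronwall:
  fixes F :: "real \<Rightarrow> real"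
  assumes d: "\<And>x. 0 \<le> x \<Longrightarrow> (F has_real_derivative F' x) (at x within {0..})"
    and c: "\<And>x. 0 < x \<Longrightarrow> x < t \<Longrightarrow> F' x \<le> C * F x" and t: "0 \<le> t"
  shows "F t \<le> exp (C * t) * F 0"
proof -
  have "F t * exp (- (C * t)) \<le> F 0 * exp (- (C * 0))"
  proof (rule halfline_ge[where F = "\<lambda>x. F x * exp (- (C * x))" and F' = "\<lambda>x. (F' x - C * F x) * exp (- (C * x))"])
    show "((\<lambda>x. F x * exp (- (C * x))) has_real_derivative (F' x - C * F x) * exp (- (C * x)))
        (at x within {0..})" if "0 \<le> x" for x
      using d[OF that] by (auto intro!: derivative_eq_intros simp: algebra_simps)
    show "(F' x - C * F x) * exp (- (C * x)) \<le> 0" if "0 < x" "x < t" for x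
      using c[OF that] by (simp add: mult_le_0_iff)
  qed (use t in auto)
  then show ?thesis by (simp add: exp_minus field_simps)
qed

text \<open>Carries information backwards: if a nonnegative \<open>F\<close> vanishes at time
  \<open>t\<close>, it already vanished at time 0.\<close>

lemma halfline_gronwall_backward:
  fixes F :: "real \<Rightarrow> real"
  assumes d: "\<And>x. 0 \<le> x \<Longrightarrow> (F has_real_derivative F' x) (at x within {0..})"
    and c: "\<And>x. 0 < x \<Longrightarrow> x < t \<Longrightarrow> - (C * F x) \<le> F' x" and t: "0 \<le> t"
  shows "F 0 \<le> exp (C * t) * F t"
proof -
  have "- F t \<le> exp (- C * t) * (- F 0)"
  proof (rule halfline_gronwall[where F = "\<lambda>x. - F x" and F' = "\<lambda>x. - F' x"])
    show "- F' x \<le> - C * - F x" if "0 < x" "x < t" for x using c[OF that] by simp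
  qed (use d t in \<open>auto intro: DERIV_minus\<close>)
  then show ?thesis by (simp add: exp_minus field_simps)
qed

section \<open>The equation as a first-order flow\<close>

text \<open>The derivatives are separate functions \<open>p\<close> and \<open>r\<close>, so that
  both the shooting trajectory and the \<open>hderiv\<close>s of an arbitrary solution are
  instances. The value at 0 and the behaviour at infinity are left open.\<close>

locale similarity_flow =
  fixes a b :: real and f p r :: "real \<Rightarrow> real"
  assumes a: "0 < a" and b: "0 \<le> b"
    and df: "0 \<le> t \<Longrightarrow> (f has_real_derivative p t) (at t within {0..})"
    and dp: "0 \<le> t \<Longrightarrow> (p has_real_derivative r t) (at t within {0..})"
    and dr: "0 \<le> t \<Longrightarrow> (r has_real_derivative b * (p t)\<^sup>2 - a * f t * r t) (at t within {0..})"
    and r0: "r 0 = - 1"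
begin

lemma cont_f: "continuous_on {0..} f" and cont_p: "continuous_on {0..} p"
  and cont_r: "continuous_on {0..} r"
  by (rule DERIV_continuous_on; use df dp dr in auto)+

definition H where "H t = r t + a * f t * p t"

lemma dH: "0 \<le> t \<Longrightarrow> (H has_real_derivative (a + b) * (p t)\<^sup>2) (at t within {0..})"
  unfolding H_def[abs_def]
  by (rule derivative_eq_intros df dp dr refl | assumption)+ (simp add: algebra_simps power2_eq_square)

text \<open>Multiplication by exp A turns r' + a f r = b p^2 into (r exp A)' = b p^2 exp A, whose
  right side has a sign.\<close>

lemma integrating_factor:
  "\<exists>A. \<forall>t\<ge>0. (A has_real_derivative a * f t) (at t within {0..})"
proof -
  have "continuous_on {0..} (\<lambda>t. a * f t)" by (intro continuous_intros cont_f)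
  from halfline_antiderivative[OF this] show ?thesis
    unfolding has_real_derivative_iff_has_vector_derivative by blast
qed

lemma r_pos_persists:
  assumes "0 \<le> s" "s \<le> t" "0 < r s"
  shows "0 < r t"
proof -
  obtain A where A: "\<And>t. 0 \<le> t \<Longrightarrow> (A has_real_derivative a * f t) (at t within {0..})"
    using integrating_factor by blast
  have "r s * exp (A s) \<le> r t * exp (A t)"
  proof (rule halfline_le[where F = "\<lambda>t. r t * exp (A t)" and F' = "\<lambda>t. b * (p t)\<^sup>2 * exp (A t)"])
    show "((\<lambda>t. r t * exp (A t)) has_real_derivative b * (p x)\<^sup>2 * exp (A x)) (at x within {0..})"
      if "0 \<le> x" for x
      by (rule derivative_eq_intros dr A that refl)+ (simp add: algebra_simps)
  qed (use assms b in auto)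
  then show ?thesis using assms(3) by (smt (verit) exp_gt_zero mult_pos_pos zero_less_mult_pos2)
qed

text \<open>Once \<open>r\<close> is positive it stays so. Then \<open>p\<close> stays above a
  positive constant, \<open>f\<close> eventually becomes nonnegative, and
  \<open>H = r + a f p\<close> becomes positive.\<close>

lemma concave_if_H_nonpos:
  assumes p: "\<And>t. 0 \<le> t \<Longrightarrow> 0 \<le> p t" and Hn: "\<And>t. 0 \<le> t \<Longrightarrow> H t \<le> 0" and s: "0 \<le> s"
  shows "r s \<le> 0"
proof (rule ccontr)
  assume "\<not> r s \<le> 0"
  then have rp: "0 < r t" if "s \<le> t" for t using r_pos_persists[of s t] s that by auto
  define d where "d = p (s + 1)"
  have "p s < p (s + 1)" by (rule halfline_less[OF dp]) (use rp s in auto)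
  then have d: "0 < d" using p[OF s] by (simp add: d_def)
  have pd: "d \<le> p t" if "s + 1 \<le> t" for t
    unfolding d_def by (rule halfline_le[OF dp]) (use rp s that in \<open>auto simp: less_imp_le\<close>)
  define t where "t = s + 1 + \<bar>f (s + 1)\<bar> / d"
  have t: "s + 1 \<le> t" using d by (simp add: t_def)
  have "f (s + 1) + d * (t - (s + 1)) \<le> f t"
    by (rule halfline_growth_ge[OF df]) (use pd s t in auto)
  then have "0 \<le> f t" using d by (simp add: t_def)
  then have "0 < H t" unfolding H_def using rp[of t] a pd[OF t] d t
    by (intro add_pos_nonneg mult_nonneg_nonneg) auto
  then show False using Hn[of t] t s by auto
qed

lemma p_antimono:
  assumes rn: "\<And>t. 0 \<le> t \<Longrightarrow> r t \<le> 0" and "0 \<le> s" "s \<le> t"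
  shows "p t \<le> p s"
  by (rule halfline_ge[OF dp]) (use assms in auto)

text \<open>If \<open>p\<close> stayed above some e > 0, then \<open>f\<close> would grow until a f
  p >= 1; from then on \<open>H\<close> <= 0 forces r <= -1, which drives \<open>p\<close> below
  0.\<close>

lemma p_tendsto_0:
  assumes p: "\<And>t. 0 \<le> t \<Longrightarrow> 0 \<le> p t" and Hn: "\<And>t. 0 \<le> t \<Longrightarrow> H t \<le> 0"
  shows "(p \<longlongrightarrow> 0) at_top"
proof (rule tendstoI)
  fix e :: real assume e: "0 < e"
  note rn = concave_if_H_nonpos[OF p Hn]
  have "\<exists>T\<ge>0. p T < e"
  proof (rule ccontr)
    assume "\<not> ?thesis"
    then have pe: "e \<le> p t" if "0 \<le> t" for t using that by force
    \<comment> \<open>By this time growth at rate \<open>e\<close> has lifted \<open>f\<close> to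
      \<open>1 / (a * e)\<close>, whatever the sign of \<open>f 0\<close>.\<close>
    define T where "T = (\<bar>f 0\<bar> + 1 / (a * e)) / e"
    have T: "0 \<le> T" using a e by (simp add: T_def)
    have fT: "1 / (a * e) \<le> f t" if "T \<le> t" for t
    proof -
      have "f 0 + e * (T - 0) \<le> f T" by (rule halfline_growth_ge[OF df]) (use pe T in auto)
      moreover have "f T \<le> f t" by (rule halfline_le[OF df]) (use p T that in auto)
      moreover have "e * T = \<bar>f 0\<bar> + 1 / (a * e)" using e by (simp add: T_def)
      ultimately show ?thesis by simp
    qed
    have rT: "r t \<le> -1" if "T \<le> t" for t
    proof -
      have "1 / (a * e) * e \<le> f t * p t"
        using fT[OF that] pe[of t] a e T that by (intro mult_mono) (auto intro: order_trans[rotated])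
      then have "1 \<le> a * f t * p t" using a e by (simp add: field_simps)
      then show ?thesis using Hn[of t] T that unfolding H_def by simp
    qed
    have "p (T + p T + 1) \<le> p T + (-1) * (T + p T + 1 - T)"
      by (rule halfline_growth_le[OF dp]) (use rT T p[OF T] in auto)
    then show False using p[of "T + p T + 1"] T p[OF T] by simp
  qed
  then obtain T where T: "0 \<le> T" "p T < e" by auto
  show "\<forall>\<^sub>F t in at_top. dist (p t) 0 < e"
    using eventually_ge_at_top[of T]
  proof eventually_elim
    case (elim t)
    then show ?case using p_antimono[OF rn, of T t] p[of t] T by auto
  qed
qed

lemma f_bound:
  assumes Hn: "\<And>t. 0 \<le> t \<Longrightarrow> H t \<le> 0" and t: "0 \<le> t" "0 \<le> p t"
  shows "f t \<le> sqrt ((f 0)\<^sup>2 + 2 * (p 0 / a))"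
proof -
  have "p t + a / 2 * (f t)\<^sup>2 \<le> p 0 + a / 2 * (f 0)\<^sup>2"
  proof (rule halfline_ge[where F = "\<lambda>t. p t + a / 2 * (f t)\<^sup>2" and F' = H])
    show "((\<lambda>t. p t + a / 2 * (f t)\<^sup>2) has_real_derivative H x) (at x within {0..})" if "0 \<le> x" for x
      unfolding H_def by (rule derivative_eq_intros df dp that refl)+ simp
  qed (use Hn t in auto)
  then have "(f t)\<^sup>2 \<le> (f 0)\<^sup>2 + 2 * (p 0 / a)" using t a by (simp add: field_simps)
  then show ?thesis by (rule real_le_rsqrt)
qed

section \<open>Positivity at infinity\<close>

text \<open>If \<open>p\<close> vanished at \<open>T\<close>, it would vanish from \<open>T\<close>
  on, so \<open>p\<close> and \<open>r\<close> would vanish together at some later time. Backward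
  Gronwall for p^2 + r^2 then contradicts \<open>r 0 = - 1\<close>.\<close>

lemma p_pos:
  assumes p: "\<And>t. 0 \<le> t \<Longrightarrow> 0 \<le> p t" and rn: "\<And>t. 0 \<le> t \<Longrightarrow> r t \<le> 0"
    and fn: "\<And>t. 0 \<le> t \<Longrightarrow> f t \<le> 0" and T: "0 \<le> T"
  shows "0 < p T"
proof (rule ccontr)
  assume "\<not> 0 < p T"
  then have pT: "p t = 0" if "T \<le> t" for t
    using p_antimono[OF rn T that] p[of t] p[OF T] T that by auto
  have "\<exists>x>T. r x = 0"
  proof (rule ccontr)
    assume "\<not> ?thesis"
    then have "r x < 0" if "T < x" for x using rn[of x] T that by force
    then have "- p T < - p (T + 1)"
      by (intro halfline_less[of "\<lambda>t. - p t" "\<lambda>t. - r t"]) (use T in \<open>auto intro!: derivative_intros dp\<close>)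
    then show False using pT[of T] pT[of "T+1"] by simp
  qed
  then obtain x where x: "T < x" "r x = 0" by auto
  \<comment> \<open>The 1 controls 2 p r and \<open>b * p 0\<close> controls 2 b p^2 r, as
    \<open>p\<close> is at most \<open>p 0\<close>. The remaining term -2 a f r^2 is nonnegative
    because \<open>f\<close> <= 0.\<close>
  let ?C = "1 + b * p 0"
  have "(p 0)\<^sup>2 + (r 0)\<^sup>2 \<le> exp (?C * x) * ((p x)\<^sup>2 + (r x)\<^sup>2)"
  proof (rule halfline_gronwall_backward[where F = "\<lambda>t. (p t)\<^sup>2 + (r t)\<^sup>2" and t = x and C = ?C and F' = "\<lambda>t. 2 * p t * r t + 2 * r t * (b * (p t)\<^sup>2 - a * f t * r t)"])
    show "((\<lambda>t. (p t)\<^sup>2 + (r t)\<^sup>2) has_real_derivative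
        2 * p t * r t + 2 * r t * (b * (p t)\<^sup>2 - a * f t * r t)) (at t within {0..})" if "0 \<le> t" for t
      by (rule derivative_eq_intros dp dr that refl)+ simp
    fix t :: real assume t: "0 < t"
    have m: "- ((p t)\<^sup>2 + (r t)\<^sup>2) \<le> 2 * (p t * r t)"
      using sum_squares_ge_zero[of "p t + r t" 0] by (simp add: power2_eq_square algebra_simps)
    have "(b * p t) * (- (p t * r t) * 2) \<le> (b * p 0) * ((p t)\<^sup>2 + (r t)\<^sup>2)"
      using m b p[of t] p[of 0] rn[of t] t p_antimono[OF rn, of 0 t]
      by (intro mult_mono) (auto intro!: mult_nonneg_nonneg mult_nonneg_nonpos mult_left_mono)
    moreover have "a * f t * r t * r t \<le> 0"
      using a fn[of t] t mult_nonpos_nonneg[of "a * f t" "r t * r t"]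
      by (simp add: mult.assoc mult_nonneg_nonpos)
    ultimately show "- (?C * ((p t)\<^sup>2 + (r t)\<^sup>2)) \<le> 2 * p t * r t + 2 * r t * (b * (p t)\<^sup>2 - a * f t * r t)"
      using m by (simp add: power2_eq_square algebra_simps)
  qed (use x T in auto)
  moreover have "p x = 0" using pT x by simp
  ultimately show False using x r0 by (simp add: sum_power2_eq_zero_iff) (smt (verit) zero_le_power2)
qed

text \<open>One positive value suffices, as \<open>f\<close> is nondecreasing. The condition
  \<open>b < 2 * a\<close>, which gives k < 3, reads 2 m + 1 < 2 m + 4 in the application.\<close>

lemma eventually_positive:
  assumes p: "\<And>t. 0 \<le> t \<Longrightarrow> 0 \<le> p t" and rn: "\<And>t. 0 \<le> t \<Longrightarrow> r t \<le> 0"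
    and lim: "(p \<longlongrightarrow> 0) at_top" and ab: "b < 2 * a"
  shows "\<forall>\<^sub>F t in at_top. 0 < f t"
proof -
  have small: "\<exists>t\<ge>s. p t < e" if "0 < e" for e s
  proof -
    have "\<forall>\<^sub>F t in at_top. p t < e \<and> s \<le> t"
      using order_tendstoD(2)[OF lim that] eventually_ge_at_top by (rule eventually_conj)
    then show ?thesis using eventually_happens by fastforce
  qed
  have "\<exists>T\<ge>0. 0 < f T"
  proof (rule ccontr)
    assume "\<not> ?thesis"
    then have fn: "f t \<le> 0" if "0 \<le> t" for t using that by force
    have pp: "0 < p t" if "0 \<le> t" for t by (rule p_pos[OF p rn fn that])
    have fneg: "f t < 0" if "0 \<le> t" for t
    proof -
      have "f t < f (t + 1)" by (rule halfline_less[OF df]) (use pp that in auto)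
      then show ?thesis using fn[of "t+1"] that by simp
    qed
    have Hneg: "H t < 0" if "0 \<le> t" for t
    proof -
      have "H t < H (t + 1)" by (rule halfline_less[OF dH]) (use pp a b that in \<open>auto intro!: mult_pos_pos simp: less_imp_neq[OF pp, symmetric]\<close>)
      moreover have "H (t + 1) \<le> 0"
        unfolding H_def using a fn[of "t+1"] p[of "t+1"] rn[of "t+1"] that
        by (intro add_nonpos_nonpos mult_nonpos_nonneg[of "a * f (t + 1)"] mult_nonneg_nonpos) auto
      ultimately show ?thesis by simp
    qed
    \<comment> \<open>r - b f p has derivative -(a + b) f r <= 0. A negative value c would therefore
      persist as an upper bound and, since b f p <= 0, force r <= c forever and \<open>p\<close>
      below 0.\<close>
    have r_ge: "b * f t * p t \<le> r t" if t: "0 \<le> t" for t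
    proof (rule ccontr)
      define c where "c = r t - b * f t * p t"
      assume "\<not> ?thesis"
      then have c: "c < 0" by (simp add: c_def)
      have rc: "r u \<le> c" if u: "t \<le> u" for u
      proof -
        have "r u - b * f u * p u \<le> r t - b * f t * p t"
        proof (rule halfline_ge[where F = "\<lambda>u. r u - b * f u * p u" and F' = "\<lambda>u. - ((a + b) * (f u * r u))"])
          show "((\<lambda>u. r u - b * f u * p u) has_real_derivative - ((a + b) * (f x * r x))) (at x within {0..})"
            if "0 \<le> x" for x
            by (rule derivative_eq_intros df dp dr that refl)+ (simp add: algebra_simps power2_eq_square)
          show "- ((a + b) * (f x * r x)) \<le> 0" if "t < x" for x
            using a b mult_nonpos_nonpos[OF fn rn, of x x] t that by simp
        qed (use t u in auto)
        moreover have "b * f u * p u \<le> 0"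
          using b fn[of u] p[of u] t u by (intro mult_nonpos_nonneg mult_nonneg_nonpos) auto
        ultimately show ?thesis by (simp add: c_def)
      qed
      define u where "u = t + (p t + 1) / (- c)"
      have u: "t \<le> u" using c p[OF t] by (simp add: u_def divide_nonneg_neg)
      have "p u \<le> p t + c * (u - t)" by (rule halfline_growth_le[OF dp]) (use rc t u in auto)
      also have "\<dots> = -1" using c by (simp add: u_def)
      finally show False using p[of u] t u by simp
    qed
    \<comment> \<open>By \<open>r_ge\<close>, p - (b / 2) f^2 is nondecreasing. A positive value
      would keep \<open>p\<close> away from 0.\<close>
    have p_le: "p t \<le> b / 2 * (f t)\<^sup>2" if t: "0 \<le> t" for t
    proof (rule ccontr)
      define c where "c = p t - b / 2 * (f t)\<^sup>2"
      assume "\<not> ?thesis"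
      then have c: "0 < c" by (simp add: c_def)
      obtain u where u: "t \<le> u" "p u < c" using small[OF c] by auto
      have "p t - b / 2 * (f t)\<^sup>2 \<le> p u - b / 2 * (f u)\<^sup>2"
      proof (rule halfline_le[where F = "\<lambda>u. p u - b / 2 * (f u)\<^sup>2" and F' = "\<lambda>u. r u - b * f u * p u"])
        show "((\<lambda>u. p u - b / 2 * (f u)\<^sup>2) has_real_derivative r x - b * f x * p x) (at x within {0..})"
          if "0 \<le> x" for x
          by (rule derivative_eq_intros df dp that refl)+ simp
      qed (use r_ge t u in auto)
      moreover have "0 \<le> b / 2 * (f u)\<^sup>2" using b by simp
      ultimately show False using u by (simp add: c_def)
    qed
    have bpos: "0 < b" using p_le[of 0] pp[of 0] b by (cases "b = 0") auto
    \<comment> \<open>This exponent makes the derivative of \<open>\<Phi>\<close> equal to (a + b) p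
      (-r) / (a f H), which is nonnegative since \<open>f\<close> and \<open>H\<close> are both
      negative.\<close>
    define k where "k = (a + b) / a"
    have k: "1 \<le> k" "k < 3" using a b ab by (auto simp: k_def field_simps)
    define \<Phi> where "\<Phi> t = ln (- H t) - k * ln (- f t)" for t
    \<comment> \<open>\<open>D\<close> is the constant in the upper bound D + ((3 - k) / 2) ln p for
      \<open>\<Phi>\<close>. \<open>N\<close> is chosen so that ln p < -N pushes this bound below
      \<open>\<Phi> 0\<close>.\<close>
    define D where "D = ln (a + b) - (1 - k) * ln (b / 2) / 2"
    define N where "N = 2 * (D - \<Phi> 0) / (3 - k)"
    obtain t where t: "0 \<le> t" "p t < exp (- N)" using small[of "exp (- N)" 0] by auto
    have "\<Phi> 0 \<le> \<Phi> t"
    proof (rule halfline_le[where F = \<Phi> and F' = "\<lambda>t. (a + b) * p t * (p t / H t - 1 / (a * f t))"])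
      show "(\<Phi> has_real_derivative (a + b) * p x * (p x / H x - 1 / (a * f x))) (at x within {0..})"
        if x: "0 \<le> x" for x
      proof -
        have "((\<lambda>t. ln (- H t)) has_real_derivative 1 / (- H x) * - ((a + b) * (p x)\<^sup>2)) (at x within {0..})"
          by (rule DERIV_chain2[OF DERIV_ln_divide DERIV_minus[OF dH[OF x]]]) (use Hneg[OF x] in simp)
        moreover have "((\<lambda>t. ln (- f t)) has_real_derivative 1 / (- f x) * - p x) (at x within {0..})"
          by (rule DERIV_chain2[OF DERIV_ln_divide DERIV_minus[OF df[OF x]]]) (use fneg[OF x] in simp)
        ultimately have "(\<Phi> has_real_derivative 1 / (- H x) * - ((a + b) * (p x)\<^sup>2)
            - k * (1 / (- f x) * - p x)) (at x within {0..})"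
          unfolding \<Phi>_def[abs_def] by (intro DERIV_diff DERIV_cmult)
        then show ?thesis
          by (simp add: k_def power2_eq_square right_diff_distrib mult.assoc)
      qed
      show "0 \<le> (a + b) * p x * (p x / H x - 1 / (a * f x))" if x: "0 < x" for x
      proof -
        have "H x \<le> p x * (a * f x)" using rn[of x] x by (simp add: H_def mult_ac)
        then have "1 / (a * f x) \<le> p x / H x"
          using Hneg[of x] fneg[of x] a x by (simp add: field_simps mult_less_0_iff)
        then show ?thesis using a b p[of x] x by (intro mult_nonneg_nonneg) auto
      qed
    qed (use t in auto)
    also have "\<Phi> t < \<Phi> 0"
    proof -
      have "- H t \<le> (a + b) * (- f t * p t)" using r_ge[OF t(1)] by (simp add: H_def algebra_simps)
      then have "ln (- H t) \<le> ln ((a + b) * (- f t * p t))"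
        using Hneg[OF t(1)] by (subst ln_le_cancel_iff) auto
      also have "\<dots> = ln (a + b) + (ln (- f t) + ln (p t))"
        using a b fneg[OF t(1)] pp[OF t(1)] ln_mult_pos[of "a + b" "- f t * p t"]
          ln_mult_pos[of "- f t" "p t"] mult_neg_pos[of "f t" "p t"] by simp
      finally have 1: "ln (- H t) \<le> ln (a + b) + (ln (- f t) + ln (p t))" .
      \<comment> \<open>Since 1 - k <= 0, bounding \<open>\<Phi>\<close> from above needs a lower
        bound on ln (-f); \<open>p_le\<close> provides it.\<close>
      have "ln (p t) \<le> ln (b / 2 * (- f t)^2)"
        using p_le[OF t(1)] pp[OF t(1)] by (subst ln_le_cancel_iff) auto
      also have "\<dots> = ln (b / 2) + 2 * ln (- f t)"
        using bpos fneg[OF t(1)] ln_mult_pos[of "b / 2" "(- f t)\<^sup>2"] ln_realpow[of "- f t" 2]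
        by simp
      finally have "(1 - k) * ln (- f t) \<le> (1 - k) * ((ln (p t) - ln (b / 2)) / 2)"
        using k by (intro mult_left_mono_neg) auto
      with 1 have 2: "\<Phi> t \<le> D + (3 - k) / 2 * ln (p t)"
        by (simp add: \<Phi>_def D_def field_simps)
      have "ln (p t) < - N" using t pp[OF t(1)] by (metis ln_exp ln_less_cancel_iff exp_gt_zero)
      then have "(3 - k) / 2 * ln (p t) < (3 - k) / 2 * (- N)" using k by (intro mult_strict_left_mono) auto
      also have "\<dots> = \<Phi> 0 - D" proof -
        have "(3 - k) * N = 2 * (D - \<Phi> 0)" using k by (simp add: N_def)
        then show ?thesis by (simp add: field_simps)
      qed
      finally show ?thesis using 2 by simp
    qed
    finally show False by simp
  qed
  then obtain T where T: "0 \<le> T" "0 < f T" by auto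
  show ?thesis
    using eventually_ge_at_top[of T]
  proof eventually_elim
    case (elim t)
    have "f T \<le> f t" by (rule halfline_le[OF df]) (use p T elim in auto)
    then show ?case using T by simp
  qed
qed

end

section \<open>Comparison of two flows\<close>

text \<open>While q <= p, also g <= f, and r - s solves a linear equation with source b (p^2 - q^2)
  - a (f - g) s >= 0. Hence s <= r, the gap cannot shrink, and a first crossing is
  impossible.\<close>

lemma slope_gap_persists:
  assumes "similarity_flow a b f p r" "similarity_flow a b g q s"
    and p: "\<And>t. 0 \<le> t \<Longrightarrow> 0 \<le> p t" and q: "\<And>t. 0 \<le> t \<Longrightarrow> 0 \<le> q t"
    and s: "\<And>t. 0 \<le> t \<Longrightarrow> s t \<le> 0"
    and init: "f 0 = g 0" "q 0 < p 0" and T: "0 \<le> T"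
  shows "p 0 - q 0 \<le> p T - q T"
proof -
  interpret F: similarity_flow a b f p r by fact
  interpret G: similarity_flow a b g q s by fact
  obtain A where A: "\<And>t. 0 \<le> t \<Longrightarrow> (A has_real_derivative a * f t) (at t within {0..})"
    using F.integrating_factor by blast
  have step: "p 0 - q 0 \<le> p T - q T" if T: "0 \<le> T" and gap: "\<And>t. 0 \<le> t \<Longrightarrow> t < T \<Longrightarrow> q t \<le> p t" for T
  proof -
    have h: "g t \<le> f t" if "0 \<le> t" "t < T" for t
    proof -
      have "f 0 - g 0 \<le> f t - g t"
        by (rule halfline_le[where F = "\<lambda>t. f t - g t" and F' = "\<lambda>t. p t - q t"])
          (use that gap in \<open>auto intro!: derivative_intros F.df G.df\<close>)
      then show ?thesis using init by simp
    qed
    have r: "s t \<le> r t" if t: "0 \<le> t" "t < T" for t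
    proof -
      have "(r 0 - s 0) * exp (A 0) \<le> (r t - s t) * exp (A t)"
      proof (rule halfline_le[where F = "\<lambda>t. (r t - s t) * exp (A t)" and F' = "\<lambda>t. (b * ((p t)\<^sup>2 - (q t)\<^sup>2) - a * (f t - g t) * s t) * exp (A t)"])
        show "((\<lambda>t. (r t - s t) * exp (A t)) has_real_derivative
            (b * ((p x)\<^sup>2 - (q x)\<^sup>2) - a * (f x - g x) * s x) * exp (A x)) (at x within {0..})" if "0 \<le> x" for x
          by (rule derivative_eq_intros F.dr G.dr A that refl)+ (simp add: algebra_simps)
        show "0 \<le> (b * ((p x)\<^sup>2 - (q x)\<^sup>2) - a * (f x - g x) * s x) * exp (A x)" if "0 < x" "x < t" for x
        proof -
          have "0 \<le> b * ((p x)\<^sup>2 - (q x)\<^sup>2)"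
            using F.b gap[of x] q[of x] that t by (intro mult_nonneg_nonneg) (auto intro!: power_mono)
          moreover have "a * (f x - g x) * s x \<le> 0"
            using F.a h[of x] s[of x] that t by (intro mult_nonneg_nonpos) auto
          ultimately show ?thesis by simp
        qed
      qed (use t in auto)
      then have "0 \<le> (r t - s t) * exp (A t)" by (simp add: F.r0 G.r0)
      then show ?thesis by (simp add: zero_le_mult_iff)
    qed
    have "p 0 - q 0 \<le> p T - q T"
      by (rule halfline_le[where F = "\<lambda>t. p t - q t" and F' = "\<lambda>t. r t - s t"])
        (use T r in \<open>auto intro!: derivative_intros F.dp G.dp\<close>)
    then show ?thesis by simp
  qed
  have "q t < p t" if "0 \<le> t" for t
  proof (rule ccontr)
    assume "\<not> q t < p t"
    \<comment> \<open>\<open>S\<close> is compact, so there is a first time at which the gap is no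
      longer positive; \<open>step\<close> applies up to that time.\<close>
    define S where "S = {0..t} \<inter> (\<lambda>t. p t - q t) -` {..0}"
    have "continuous_on {0..t} (\<lambda>t. p t - q t)"
      by (intro continuous_intros continuous_on_subset[OF F.cont_p] continuous_on_subset[OF G.cont_p]) auto
    then have "closed S" unfolding S_def by (rule continuous_closed_preimage) auto
    then have "compact S" using bounded_subset[of "{0..t}" S] by (auto simp: compact_eq_bounded_closed S_def)
    moreover have "S \<noteq> {}" using \<open>\<not> q t < p t\<close> that by (auto simp: S_def)
    ultimately obtain u where u: "u \<in> S" "\<And>v. v \<in> S \<Longrightarrow> u \<le> v" by (meson compact_attains_inf)
    have "q v \<le> p v" if "0 \<le> v" "v < u" for v
      using u(2)[of v] u(1) that by (force simp: S_def)
    then have "p 0 - q 0 \<le> p u - q u" using u(1) by (intro step) (auto simp: S_def)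
    then show False using u(1) init by (auto simp: S_def)
  qed
  then show ?thesis using step[OF T] by (simp add: less_imp_le)
qed

lemma initial_value_unique:
  assumes "similarity_flow a b f p r" "similarity_flow a b g q s"
    and init: "f 0 = g 0" "p 0 = q 0" and T: "0 \<le> T"
  shows "f T = g T"
proof -
  interpret F: similarity_flow a b f p r by fact
  interpret G: similarity_flow a b g q s by fact
  have bdd: "\<exists>C\<ge>0. \<forall>t\<in>{0..T}. \<bar>\<phi> t\<bar> \<le> C" if "continuous_on {0..} \<phi>" for \<phi> :: "real \<Rightarrow> real"
  proof -
    have "compact (\<phi> ` {0..T})"
      by (rule compact_continuous_image) (auto intro: continuous_on_subset[OF that])
    then show ?thesis
      using compact_imp_bounded bounded_pos by (metis imageI less_imp_le real_norm_def)
  qed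
  \<comment> \<open>From f r - g s = f (r - s) + s (f - g) and p^2 - q^2 = (p + q) (p - q), the
    differences satisfy a linear system whose coefficients are bounded on
    \<open>{0..T}\<close>.\<close>
  have "continuous_on {0..} (\<lambda>t. a * f t)" by (intro continuous_intros F.cont_f)
  from bdd[OF this] obtain C1 where C1: "0 \<le> C1" "\<And>t. t \<in> {0..T} \<Longrightarrow> \<bar>a * f t\<bar> \<le> C1"
    by blast
  have "continuous_on {0..} (\<lambda>t. a * s t)" by (intro continuous_intros G.cont_r)
  from bdd[OF this] obtain C2 where C2: "0 \<le> C2" "\<And>t. t \<in> {0..T} \<Longrightarrow> \<bar>a * s t\<bar> \<le> C2"
    by blast
  have "continuous_on {0..} (\<lambda>t. b * (p t + q t))" by (intro continuous_intros F.cont_p G.cont_p)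
  from bdd[OF this] obtain C3 where C3: "0 \<le> C3" "\<And>t. t \<in> {0..T} \<Longrightarrow> \<bar>b * (p t + q t)\<bar> \<le> C3"
    by blast
  define E where "E t = (f t - g t)\<^sup>2 + (p t - q t)\<^sup>2 + (r t - s t)\<^sup>2" for t
  have y: "2 * c * (x * y) \<le> C * (x\<^sup>2 + y\<^sup>2)" if "\<bar>c\<bar> \<le> C" for c C x y :: real
  proof -
    have "2 * \<bar>x * y\<bar> \<le> x\<^sup>2 + y\<^sup>2"
      using sum_squares_bound[of "\<bar>x\<bar>" "\<bar>y\<bar>"] by (simp add: abs_mult)
    then have "\<bar>c\<bar> * (2 * \<bar>x * y\<bar>) \<le> C * (x\<^sup>2 + y\<^sup>2)" using that by (intro mult_mono) auto
    moreover have "2 * c * (x * y) \<le> \<bar>c\<bar> * (2 * \<bar>x * y\<bar>)"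
      using abs_ge_self[of "c * (x * y)"] by (simp add: abs_mult)
    ultimately show ?thesis by linarith
  qed
  let ?d = "\<lambda>t. 2 * 1 * ((f t - g t) * (p t - q t)) + 2 * 1 * ((p t - q t) * (r t - s t))
    + 2 * (- (a * f t)) * ((r t - s t) * (r t - s t)) + 2 * (- (a * s t)) * ((f t - g t) * (r t - s t))
    + 2 * (b * (p t + q t)) * ((p t - q t) * (r t - s t))"
  have "E T \<le> exp ((2 + 2 * C1 + C2 + C3) * T) * E 0"
  proof (rule halfline_gronwall[where F = E and F' = ?d])
    show "(E has_real_derivative ?d t) (at t within {0..})" if "0 \<le> t" for t
      unfolding E_def[abs_def]
      by (rule derivative_eq_intros F.df F.dp F.dr G.df G.dp G.dr that refl)+
        (simp add: algebra_simps power2_eq_square)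
    fix t assume "0 < t" "t < T"
    then have t: "t \<in> {0..T}" by auto
    let ?x = "(f t - g t)\<^sup>2" and ?y = "(p t - q t)\<^sup>2" and ?z = "(r t - s t)\<^sup>2"
    have "?d t \<le> 1 * (?x + ?y) + 1 * (?y + ?z) + C1 * (?z + ?z) + C2 * (?x + ?z) + C3 * (?y + ?z)"
      by (intro add_mono y) (use C1(2)[OF t] C2(2)[OF t] C3(2)[OF t] in auto)
    also have "\<dots> \<le> (2 + 2 * C1 + C2 + C3) * (?x + ?y + ?z)"
    proof -
      have "0 \<le> C1 * ?x" "0 \<le> C1 * ?y" "0 \<le> C2 * ?y" "0 \<le> C3 * ?x" "0 \<le> ?x" "0 \<le> ?y" "0 \<le> ?z"
        using C1 C2 C3 by auto
      then show ?thesis by (simp add: ring_distribs)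
    qed
    finally show "?d t \<le> (2 + 2 * C1 + C2 + C3) * E t" by (simp add: E_def)
  qed (use T in auto)
  also have "E 0 = 0" by (simp add: E_def init F.r0 G.r0)
  finally have "E T \<le> 0" by simp
  then have "(f T - g T)\<^sup>2 \<le> 0" unfolding E_def by (smt (verit) zero_le_power2)
  then show ?thesis by simp
qed

section \<open>Shooting\<close>

text \<open>
  As long as \<open>p < 0\<close> the truncated system freezes \<open>f\<close> and \<open>H\<close>, and \<open>p\<close> is affine with slope \<open>H\<close>.
\<close>
lemma negative_slope_absorbing:
  fixes P q :: "real \<Rightarrow> real"
  assumes P: "\<And>y. 0 \<le> P y" "\<And>y. y \<le> 0 \<Longrightarrow> P y = 0" and c: "0 \<le> c"
    and df: "\<And>t. 0 \<le> t \<Longrightarrow> (f has_real_derivative P (p t)) (at t within {0..})"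
    and dW: "\<And>t. 0 \<le> t \<Longrightarrow> (W has_real_derivative H t) (at t within {0..})"
    and dH: "\<And>t. 0 \<le> t \<Longrightarrow> (H has_real_derivative c * (P (p t))\<^sup>2) (at t within {0..})"
    and p: "\<And>t. p t = W t - q (f t)" and q: "continuous_on UNIV q"
    and init: "0 \<le> p 0 \<or> H 0 < 0"
    and t: "0 \<le> t" "p t < 0" and u: "0 \<le> u"
  shows "H u < 0"
proof -
  have cont: "continuous_on {0..} p"
  proof -
    have "continuous_on {0..} f" "continuous_on {0..} W"
      by (rule DERIV_continuous_on; use df dW in auto)+
    then show ?thesis unfolding p[abs_def]
      by (intro continuous_intros continuous_on_compose2[OF q]) auto
  qed
  have affine: "H v = H s \<and> p v = p s + H s * (v - s)"
    if s: "0 \<le> s" "s \<le> v" and neg: "\<And>x. s < x \<Longrightarrow> x < v \<Longrightarrow> p x < 0" for s v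
  proof -
    have P0: "P (p x) = 0" if "s < x" "x < v" for x using P(2) neg[OF that] by simp
    have H: "H x \<le> H s" if x: "s \<le> x" "x \<le> v" for x
      by (rule halfline_ge[OF dH]) (use x s P0 in auto)
    have H': "H s \<le> H x" if x: "s \<le> x" "x \<le> v" for x
      by (rule halfline_le[OF dH]) (use x s P0 in auto)
    have f: "f v = f s"
    proof (rule antisym)
      show "f v \<le> f s" by (rule halfline_ge[OF df]) (use s P0 in auto)
      show "f s \<le> f v" by (rule halfline_le[OF df]) (use s P0 in auto)
    qed
    have "W s + H s * (v - s) \<le> W v" by (rule halfline_growth_ge[OF dW]) (use s H' in auto)
    moreover have "W v \<le> W s + H s * (v - s)" by (rule halfline_growth_le[OF dW]) (use s H in auto)
    ultimately show ?thesis using H[of v] H'[of v] s f by (simp add: p)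
  qed
  have comp: "compact ({s..v} \<inter> p -` {0..})" if "0 \<le> s" for s v
  proof -
    have "closed ({s..v} \<inter> p -` {0..})"
      by (rule continuous_closed_preimage) (use that in \<open>auto intro: continuous_on_subset[OF cont]\<close>)
    then show ?thesis using bounded_subset[of "{s..v}" "{s..v} \<inter> p -` {0..}"]
      by (auto simp: compact_eq_bounded_closed)
  qed
  \<comment> \<open>If \<open>p\<close> was negative throughout, \<open>init\<close> gives
    \<open>H 0 < 0\<close> and \<open>H\<close> has not changed. Otherwise \<open>p\<close> has
    fallen below 0 since its last nonnegative time, along a line of slope
    \<open>H t\<close>.\<close>
  have Ht: "H t < 0"
  proof (cases "{0..t} \<inter> p -` {0..} = {}")
    case True
    then have neg: "p x < 0" if "0 \<le> x" "x \<le> t" for x using that by force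
    then show ?thesis using affine[of 0 t] t init by force
  next
    case False
    then obtain s where s: "s \<in> {0..t} \<inter> p -` {0..}"
      and m: "\<And>x. x \<in> {0..t} \<inter> p -` {0..} \<Longrightarrow> x \<le> s"
      using compact_attains_sup[OF comp[OF order_refl] False] by blast
    have "p x < 0" if "s < x" "x < t" for x using m[of x] s that by force
    with affine[of s t] s have A: "H t = H s" "p t = p s + H s * (t - s)" by auto
    then have "H s * (t - s) < 0" using t s by auto
    then show ?thesis using A s by (auto simp: mult_less_0_iff)
  qed
  show ?thesis
  proof (cases "u \<le> t")
    case True
    have "H u \<le> H t" by (rule halfline_le[OF dH]) (use u True c in auto)
    then show ?thesis using Ht by simp
  next
    case False
    \<comment> \<open>Up to its first return to nonnegative values \<open>p\<close> would follow a
      line of negative slope starting below 0.\<close>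
    have "p x < 0" if x: "t \<le> x" for x
    proof (rule ccontr)
      assume "\<not> p x < 0"
      then have "{t..x} \<inter> p -` {0..} \<noteq> {}" using x by auto
      then obtain s where s: "s \<in> {t..x} \<inter> p -` {0..}"
        and m: "\<And>y. y \<in> {t..x} \<inter> p -` {0..} \<Longrightarrow> s \<le> y"
        using compact_attains_inf[OF comp[OF t(1)]] by blast
      have "p y < 0" if "t < y" "y < s" for y using m[of y] s that by force
      with affine[of t s] s t have "p s = p t + H t * (s - t)" by auto
      moreover have "H t * (s - t) \<le> 0" using Ht s by (intro mult_nonpos_nonneg) auto
      ultimately show False using s t by auto
    qed
    then show ?thesis using affine[of t u] Ht t False by auto
  qed
qed

text \<open>In the variables (f, W, H) the nonlinearity enters only through W - (a / 2) f^2 and its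
  square, so clipping \<open>f\<close> and the slope makes the field Lipschitz. Clipping the slope
  at 0 from below also freezes \<open>f\<close> and \<open>H\<close> when it turns negative.\<close>

lemma truncated_flow:
  fixes a c M K :: real
  assumes a: "0 \<le> a" and c: "0 \<le> c" and M: "0 \<le> M" and K: "0 \<le> K"
  defines "P \<equiv> \<lambda>y. max 0 (min M y)" and "q \<equiv> \<lambda>x. a / 2 * (max (- K) (min K x))\<^sup>2"
  obtains f W H :: "real \<times> real \<times> real \<Rightarrow> real \<Rightarrow> real"
  where "\<And>x. (f x 0, W x 0, H x 0) = x"
    and "\<And>x t. 0 \<le> t \<Longrightarrow> (f x has_real_derivative P (W x t - q (f x t))) (at t within {0..})"
    and "\<And>x t. 0 \<le> t \<Longrightarrow> (W x has_real_derivative H x t) (at t within {0..})"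
    and "\<And>x t. 0 \<le> t \<Longrightarrow> (H x has_real_derivative c * (P (W x t - q (f x t)))\<^sup>2) (at t within {0..})"
    and "\<And>t. 0 \<le> t \<Longrightarrow> continuous_on UNIV (\<lambda>x. W x t - q (f x t))"
    and "\<And>t. 0 \<le> t \<Longrightarrow> continuous_on UNIV (\<lambda>x. H x t)"
proof -
  define F where "F = (\<lambda>(f :: real, W :: real, H :: real). (P (W - q f), H, c * (P (W - q f))\<^sup>2))"
  \<comment> \<open>The slope has Lipschitz constant 1 + a K, its square on [0, M] adds the factor 2
    M, and the final 1 is for the component \<open>H\<close>.\<close>
  let ?L = "(1 + c * (2 * M)) * (1 + a * K) + 1"
  have lip: "norm (F x - F y) \<le> ?L * norm (x - y)" for x y
  proof -
    obtain f W H where x: "x = (f, W, H)" by (cases x) auto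
    obtain f' W' H' where y: "y = (f', W', H')" by (cases y) auto
    define n where "n = norm (x - y)"
    have n0: "0 \<le> n" by (simp add: n_def)
    have nf: "\<bar>f - f'\<bar> \<le> n" 
      using norm_fst_le[of "f - f'" "(W - W', H - H')"] by (simp add: n_def x y)
    have "norm (W - W', H - H') \<le> n"
      using norm_snd_le[of "(W - W', H - H')" "f - f'"] by (simp add: n_def x y)
    then have nW: "\<bar>W - W'\<bar> \<le> n" and nH: "\<bar>H - H'\<bar> \<le> n"
      using norm_fst_le[of "W - W'" "H - H'"] norm_snd_le[of "H - H'" "W - W'"] by auto
    define \<pi> \<pi>' where "\<pi> = P (W - q f)" and "\<pi>' = P (W' - q f')"
    have q: "\<bar>q f - q f'\<bar> \<le> a * K * n"
    proof -
      define k k' where "k = max (- K) (min K f)" and "k' = max (- K) (min K f')"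
      have "\<bar>k + k'\<bar> * \<bar>k - k'\<bar> \<le> (2 * K) * n"
        using nf n0 K by (intro mult_mono) (auto simp: k_def k'_def)
      then have "a / 2 * (\<bar>k + k'\<bar> * \<bar>k - k'\<bar>) \<le> a / 2 * ((2 * K) * n)"
        using a by (intro mult_left_mono) auto
      moreover have "q f - q f' = a / 2 * ((k + k') * (k - k'))"
        by (simp add: q_def k_def k'_def power2_eq_square algebra_simps)
      ultimately show ?thesis using a by (simp only: abs_mult)
    qed
    have 1: "\<bar>\<pi> - \<pi>'\<bar> \<le> (1 + a * K) * n"
      using q nW by (simp add: \<pi>_def \<pi>'_def P_def ring_distribs)
    have \<pi>: "0 \<le> \<pi>" "\<pi> \<le> M" "0 \<le> \<pi>'" "\<pi>' \<le> M"
      using M by (auto simp: \<pi>_def \<pi>'_def P_def)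
    have "\<bar>\<pi> + \<pi>'\<bar> * \<bar>\<pi> - \<pi>'\<bar> \<le> (2 * M) * ((1 + a * K) * n)"
      by (rule mult_mono[OF _ 1]) (use \<pi> M in auto)
    then have "c * (\<bar>\<pi> + \<pi>'\<bar> * \<bar>\<pi> - \<pi>'\<bar>) \<le> c * ((2 * M) * ((1 + a * K) * n))"
      using c by (intro mult_left_mono) auto
    moreover have "c * \<pi>\<^sup>2 - c * \<pi>'\<^sup>2 = c * ((\<pi> + \<pi>') * (\<pi> - \<pi>'))"
      by (simp add: power2_eq_square algebra_simps)
    ultimately have 2: "\<bar>c * \<pi>\<^sup>2 - c * \<pi>'\<^sup>2\<bar> \<le> c * ((2 * M) * ((1 + a * K) * n))"
      using c by (simp add: abs_mult)
    have "F x - F y = (\<pi> - \<pi>', H - H', c * \<pi>\<^sup>2 - c * \<pi>'\<^sup>2)"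
      by (simp add: F_def x y \<pi>_def \<pi>'_def)
    then have "norm (F x - F y) \<le> \<bar>\<pi> - \<pi>'\<bar> + (\<bar>H - H'\<bar> + \<bar>c * \<pi>\<^sup>2 - c * \<pi>'\<^sup>2\<bar>)"
      using norm_Pair_le[of "\<pi> - \<pi>'" "(H - H', c * \<pi>\<^sup>2 - c * \<pi>'\<^sup>2)"]
        norm_Pair_le[of "H - H'" "c * \<pi>\<^sup>2 - c * \<pi>'\<^sup>2"] by simp
    also have "\<dots> \<le> ?L * n" using 1 2 nH by (simp add: algebra_simps)
    finally show ?thesis by (simp add: n_def)
  qed
  have "0 < ?L" using a c M K by (intro add_nonneg_pos mult_nonneg_nonneg) auto
  from lipschitz_flow[of ?L F, OF this lip] obtain Y where Y0: "\<And>x. Y x 0 = x"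
    and dY: "\<And>x t. 0 \<le> t \<Longrightarrow> (Y x has_vector_derivative F (Y x t)) (at t within {0..})"
    and cY: "\<And>t. 0 \<le> t \<Longrightarrow> continuous_on UNIV (\<lambda>x. Y x t)" by blast
  show ?thesis
  proof
    show "(fst (Y x 0), fst (snd (Y x 0)), snd (snd (Y x 0))) = x" for x by (simp add: Y0)
    fix t :: real assume t: "0 \<le> t"
    {
      fix x
      have F: "F (Y x t) = (P (fst (snd (Y x t)) - q (fst (Y x t))), snd (snd (Y x t)),
          c * (P (fst (snd (Y x t)) - q (fst (Y x t))))\<^sup>2)"
        by (simp add: F_def split: prod.splits)
      note 1 = bounded_linear.has_vector_derivative[OF bounded_linear_fst dY[OF t, of x]]
      note 2 = bounded_linear.has_vector_derivative[OF bounded_linear_snd dY[OF t, of x]]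
      note 3 = bounded_linear.has_vector_derivative[OF bounded_linear_fst 2]
        bounded_linear.has_vector_derivative[OF bounded_linear_snd 2]
      show "((\<lambda>t. fst (Y x t)) has_real_derivative P (fst (snd (Y x t)) - q (fst (Y x t)))) (at t within {0..})"
        and "((\<lambda>t. fst (snd (Y x t))) has_real_derivative snd (snd (Y x t))) (at t within {0..})"
        and "((\<lambda>t. snd (snd (Y x t))) has_real_derivative c * (P (fst (snd (Y x t)) - q (fst (Y x t))))\<^sup>2) (at t within {0..})"
        using 1 3 by (simp_all add: F has_real_derivative_iff_has_vector_derivative)
    }
    show "continuous_on UNIV (\<lambda>x. fst (snd (Y x t)) - q (fst (Y x t)))"
      unfolding q_def by (intro continuous_intros cY t)
    show "continuous_on UNIV (\<lambda>x. snd (snd (Y x t)))"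
      by (intro continuous_intros cY t)
  qed
qed

text \<open>
  Up to time \<open>k / \<alpha>\<close> a trajectory of large initial slope \<open>\<alpha>\<close> stays bounded and keeps slope at least
  \<open>\<alpha> / 2\<close>; \<open>k\<close> is chosen so that the resulting gain \<open>c k \<alpha> / 4\<close> of \<open>H\<close> outweighs \<open>H(0)\<close>.
\<close>
lemma large_slope_escapes:
  fixes P q :: "real \<Rightarrow> real"
  assumes a: "0 < a" and c: "0 < c"
    and k: "k = 4 * (a * \<bar>\<gamma>\<bar> + 1) / c"
    and \<alpha>: "\<alpha> = 2 * ((1 + a * \<bar>\<gamma>\<bar>) * k + a / 2 * (\<bar>\<gamma>\<bar> + 2 * k)\<^sup>2) + a / 2 * \<gamma>\<^sup>2 + 2"
    and M: "M = \<alpha> + a / 2 * \<gamma>\<^sup>2"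
    and P: "\<And>y. P y = max 0 (min M y)" and q: "\<And>x. q x \<le> a / 2 * x\<^sup>2"
    and df: "\<And>t. 0 \<le> t \<Longrightarrow> (f has_real_derivative P (W t - q (f t))) (at t within {0..})"
    and dW: "\<And>t. 0 \<le> t \<Longrightarrow> (W has_real_derivative H t) (at t within {0..})"
    and dH: "\<And>t. 0 \<le> t \<Longrightarrow> (H has_real_derivative c * (P (W t - q (f t)))\<^sup>2) (at t within {0..})"
    and init: "f 0 = - \<gamma>" "W 0 = \<alpha> + a / 2 * \<gamma>\<^sup>2" "H 0 = - 1 - a * \<gamma> * \<alpha>"
  shows "\<exists>t\<ge>0. 0 < H t"
proof -
  define T where "T = k / \<alpha>"
  have k0: "0 \<le> k" using a c by (simp add: k)
  \<comment> \<open>The summand 2 in \<open>\<alpha>\<close> yields T <= k. The summand a \<gamma>^2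
    / 2 yields M <= 2 \<alpha>, so \<open>f\<close> moves by at most 2 k up to time
    \<open>T\<close>.\<close>
  have \<alpha>2: "2 \<le> \<alpha>" "a / 2 * \<gamma>\<^sup>2 \<le> \<alpha>" using a k0 by (auto simp: \<alpha>)
  have M2: "0 \<le> M" "M \<le> 2 * \<alpha>" using a \<alpha>2 by (auto simp: M)
  have T: "0 \<le> T" "\<alpha> * T = k" using k0 \<alpha>2 by (auto simp: T_def)
  have Tk: "T \<le> k" using T mult_right_mono[of 1 \<alpha> T] \<alpha>2 by simp
  have H0: "H 0 \<ge> - (1 + a * \<bar>\<gamma>\<bar> * \<alpha>)"
    using a \<alpha>2 abs_ge_self[of "a * \<gamma> * \<alpha>"] by (simp add: init abs_mult)
  have half: "\<alpha> / 2 \<le> P (W t - q (f t))" if t: "0 \<le> t" "t \<le> T" for t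
  proof -
    have "0 \<le> a / 2 * \<gamma>\<^sup>2" using a by simp
    have "W 0 + H 0 * (t - 0) \<le> W t"
    proof (rule halfline_growth_ge[OF dW])
      show "H 0 \<le> H x" if "0 < x" for x by (rule halfline_le[OF dH]) (use c that in auto)
    qed (use t in auto)
    then have "W 0 + H 0 * t \<le> W t" by simp
    moreover have "- ((1 + a * \<bar>\<gamma>\<bar>) * k) \<le> H 0 * t"
    proof -
      have "(1 + a * \<bar>\<gamma>\<bar> * \<alpha>) * t \<le> (1 + a * \<bar>\<gamma>\<bar> * \<alpha>) * T"
        using t a \<alpha>2 by (intro mult_left_mono) auto
      also have "\<dots> = T + a * \<bar>\<gamma>\<bar> * k" using T by (simp add: algebra_simps)
      also have "\<dots> \<le> (1 + a * \<bar>\<gamma>\<bar>) * k" using Tk by (simp add: algebra_simps)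
      finally have "(1 + a * \<bar>\<gamma>\<bar> * \<alpha>) * t \<le> (1 + a * \<bar>\<gamma>\<bar>) * k" .
      moreover have "(- (1 + a * \<bar>\<gamma>\<bar> * \<alpha>)) * t \<le> H 0 * t" using H0 t by (intro mult_right_mono) auto
      ultimately show ?thesis unfolding mult_minus_left by linarith
    qed
    ultimately have W: "\<alpha> - (1 + a * \<bar>\<gamma>\<bar>) * k \<le> W t"
      using init(2) \<open>0 \<le> a / 2 * \<gamma>\<^sup>2\<close> by linarith
    have "f t \<le> f 0 + M * (t - 0)" by (rule halfline_growth_le[OF df]) (use t M2 P in auto)
    moreover have "M * t \<le> (2 * \<alpha>) * T" using M2 t \<alpha>2 by (intro mult_mono) auto
    moreover have "f 0 \<le> f t" by (rule halfline_le[OF df]) (use t P in auto)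
    ultimately have "\<bar>f t\<bar> \<le> \<bar>\<gamma>\<bar> + 2 * k" using init T k0 by (simp add: mult.assoc)
    then have "\<bar>f t\<bar>\<^sup>2 \<le> (\<bar>\<gamma>\<bar> + 2 * k)\<^sup>2" by (intro power_mono) auto
    then have "q (f t) \<le> a / 2 * (\<bar>\<gamma>\<bar> + 2 * k)\<^sup>2"
      using q[of "f t"] a by (simp add: field_simps) (smt (verit) mult_left_mono)
    \<comment> \<open>Half of \<open>\<alpha>\<close> covers both the possible loss of
      \<open>W\<close> and the bound on q (f t); this is why their sum is doubled in
      \<open>\<alpha>\<close>.\<close>
    then have "\<alpha> / 2 \<le> W t - q (f t)" using W \<alpha> a zero_le_power2[of \<gamma>]
      by (smt (verit) mult_nonneg_nonneg divide_nonneg_nonneg field_sum_of_halves)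
    then show ?thesis using \<alpha>2 a by (auto simp: P M)
  qed
  have "H 0 + c * (\<alpha> / 2)\<^sup>2 * (T - 0) \<le> H T"
    by (rule halfline_growth_ge[OF dH])
      (use T c \<alpha>2 half in \<open>auto intro!: mult_left_mono power_mono simp: less_imp_le\<close>)
  also have "c * (\<alpha> / 2)\<^sup>2 * (T - 0) = c * \<alpha> / 4 * (\<alpha> * T)" by (simp add: power2_eq_square)
  also have "\<dots> = (a * \<bar>\<gamma>\<bar> + 1) * \<alpha>" using c by (simp add: T k)
  finally have "0 < H T" using H0 \<alpha>2 by (simp add: algebra_simps)
  then show ?thesis using T by blast
qed

lemma monotone_flow_exists:
  assumes a: "0 < a" and b: "0 \<le> b"
  shows "\<exists>f p r. similarity_flow a b f p r \<and> f 0 = - \<gamma> \<and>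
    (\<forall>t\<ge>0. 0 \<le> p t \<and> r t + a * f t * p t \<le> 0)"
proof -
  define c where "c = a + b"
  have c: "0 < c" using a b by (simp add: c_def)
  define k where "k = 4 * (a * \<bar>\<gamma>\<bar> + 1) / c"
  define \<alpha>1 where "\<alpha>1 = 2 * ((1 + a * \<bar>\<gamma>\<bar>) * k + a / 2 * (\<bar>\<gamma>\<bar> + 2 * k)\<^sup>2) + a / 2 * \<gamma>\<^sup>2 + 2"
  \<comment> \<open>For \<alpha> in [-\<epsilon>, 0) this gives H(0) = -1 - a \<gamma> \<alpha> < 0,
    as \<open>negative_slope_absorbing\<close> requires, while the left endpoint already has
    negative slope at time 0.\<close>
  define \<epsilon> where "\<epsilon> = 1 / (a * \<bar>\<gamma>\<bar> + 1)"
  \<comment> \<open>\<open>M\<close> is the value of W(0) for the largest slope considered.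
    \<open>K\<close> exceeds the size of \<open>f\<close> compatible with W <= M and nonnegative
    slope, and also \<bar>\<gamma>\<bar>.\<close>
  define M where "M = \<alpha>1 + a / 2 * \<gamma>\<^sup>2"
  define K where "K = 2 * M / a + 1 + \<bar>\<gamma>\<bar>"
  have k0: "0 \<le> k" using a c by (simp add: k_def)
  have \<alpha>1: "0 \<le> \<alpha>1" using a k0 by (simp add: \<alpha>1_def)
  have M: "0 \<le> M" using a \<alpha>1 by (simp add: M_def)
  have K: "1 \<le> K" "\<bar>\<gamma>\<bar> \<le> K" using a M by (auto simp: K_def)
  have aK: "M < a / 2 * K\<^sup>2"
  proof -
    have "2 * M / a < K" using a M by (simp add: K_def)
    also have "K \<le> K\<^sup>2" using K by (simp add: power2_eq_square mult_le_cancel_left1)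
    finally show ?thesis using a by (simp add: field_simps)
  qed
  have \<epsilon>: "0 < \<epsilon>" "a * \<bar>\<gamma>\<bar> * \<epsilon> < 1" using a by (auto simp: \<epsilon>_def add_nonneg_pos divide_simps)
  define P where "P y = max 0 (min M y)" for y
  define q where "q x = a / 2 * (max (- K) (min K x))\<^sup>2" for x
  obtain \<phi> \<omega> \<eta> :: "real \<times> real \<times> real \<Rightarrow> real \<Rightarrow> real"
    where init: "\<And>x. (\<phi> x 0, \<omega> x 0, \<eta> x 0) = x"
      and d: "\<And>x t. 0 \<le> t \<Longrightarrow> (\<phi> x has_real_derivative P (\<omega> x t - q (\<phi> x t))) (at t within {0..})"
        "\<And>x t. 0 \<le> t \<Longrightarrow> (\<omega> x has_real_derivative \<eta> x t) (at t within {0..})"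
        "\<And>x t. 0 \<le> t \<Longrightarrow> (\<eta> x has_real_derivative c * (P (\<omega> x t - q (\<phi> x t)))\<^sup>2) (at t within {0..})"
      and cont: "\<And>t. 0 \<le> t \<Longrightarrow> continuous_on UNIV (\<lambda>x. \<omega> x t - q (\<phi> x t))"
        "\<And>t. 0 \<le> t \<Longrightarrow> continuous_on UNIV (\<lambda>x. \<eta> x t)"
    using truncated_flow[of a c M K] a c M K unfolding P_def[abs_def] q_def[abs_def] by (auto simp: less_imp_le)
  \<comment> \<open>The data f = -\<gamma>, f' = \<alpha>, f'' = -1 expressed in the coordinates (f,
    W, H).\<close>
  define I where "I \<alpha> = (- \<gamma>, \<alpha> + a / 2 * \<gamma>\<^sup>2, - 1 - a * \<gamma> * \<alpha>)" for \<alpha>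
  have init': "\<phi> (I \<alpha>) 0 = - \<gamma>" "\<omega> (I \<alpha>) 0 = \<alpha> + a / 2 * \<gamma>\<^sup>2" "\<eta> (I \<alpha>) 0 = - 1 - a * \<gamma> * \<alpha>" for \<alpha>
    using init[of "I \<alpha>"] by (simp_all add: I_def)
  have q\<gamma>: "q (- \<gamma>) = a / 2 * \<gamma>\<^sup>2"
  proof -
    have "max (- K) (min K (- \<gamma>)) = - \<gamma>" using K by auto
    then show ?thesis by (simp add: q_def)
  qed
  have qle: "q x \<le> a / 2 * x\<^sup>2" for x
  proof -
    have "\<bar>max (- K) (min K x)\<bar>\<^sup>2 \<le> \<bar>x\<bar>\<^sup>2" using K by (intro power_mono) auto
    then show ?thesis using a by (simp add: q_def)
  qed
  have contI: "continuous_on UNIV I" unfolding I_def by (intro continuous_intros)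
  define p where "p \<alpha> t = \<omega> (I \<alpha>) t - q (\<phi> (I \<alpha>) t)" for \<alpha> t
  define A where "A = (\<Union>t\<in>{0..}. {\<alpha>. p \<alpha> t < 0})"
  define B where "B = (\<Union>t\<in>{0..}. {\<alpha>. 0 < \<eta> (I \<alpha>) t})"
  have cont_p: "continuous_on UNIV (\<lambda>\<alpha>. p \<alpha> t)" if "0 \<le> t" for t
    unfolding p_def using continuous_on_compose2[OF cont(1)[OF that] contI] by simp
  have cont_\<eta>: "continuous_on UNIV (\<lambda>\<alpha>. \<eta> (I \<alpha>) t)" if "0 \<le> t" for t
    using continuous_on_compose2[OF cont(2)[OF that] contI] by simp
  have "open A" unfolding A_def
    by (intro open_UN ballI open_Collect_less cont_p continuous_intros) auto
  moreover have "open B" unfolding B_def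
    by (intro open_UN ballI open_Collect_less cont_\<eta> continuous_intros) auto
  moreover have "A \<inter> B \<inter> {- \<epsilon>..\<alpha>1} = {}"
  proof (rule ccontr)
    assume "A \<inter> B \<inter> {- \<epsilon>..\<alpha>1} \<noteq> {}"
    then obtain \<alpha> t u where \<alpha>: "- \<epsilon> \<le> \<alpha>" and t: "0 \<le> t" "p \<alpha> t < 0" and u: "0 \<le> u" "0 < \<eta> (I \<alpha>) u"
      by (auto simp: A_def B_def)
    have "0 \<le> p \<alpha> 0 \<or> \<eta> (I \<alpha>) 0 < 0"
    proof (cases "0 \<le> \<alpha>")
      case False
      have "- (a * \<gamma> * \<alpha>) \<le> \<bar>a * \<gamma> * \<alpha>\<bar>" by simp
      also have "\<dots> = a * \<bar>\<gamma>\<bar> * (- \<alpha>)" using a False by (simp add: abs_mult)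
      also have "\<dots> \<le> a * \<bar>\<gamma>\<bar> * \<epsilon>" using a \<alpha> by (intro mult_left_mono) auto
      finally show ?thesis using \<epsilon> by (simp add: init')
    qed (simp add: p_def init' q\<gamma>)
    from negative_slope_absorbing[where P = P and c = c and f = "\<phi> (I \<alpha>)" and p = "p \<alpha>"
        and W = "\<omega> (I \<alpha>)" and H = "\<eta> (I \<alpha>)" and q = q, OF _ _ _ _ _ _ _ _ this t u(1)]
    have "\<eta> (I \<alpha>) u < 0"
      using c d by (simp add: p_def P_def q_def[abs_def] continuous_intros)
    then show False using u by simp
  qed
  moreover have "- \<epsilon> \<in> A \<inter> {- \<epsilon>..\<alpha>1}"
    using \<epsilon> \<alpha>1 by (auto simp: A_def p_def init' q\<gamma> intro!: bexI[of _ 0])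
  moreover have "\<alpha>1 \<in> B \<inter> {- \<epsilon>..\<alpha>1}"
    using large_slope_escapes[OF a c k_def \<alpha>1_def M_def P_def qle d init'[of \<alpha>1]] \<epsilon> \<alpha>1 by (auto simp: B_def)
  moreover have "connected {- \<epsilon>..\<alpha>1}" by simp
  ultimately have "\<not> {- \<epsilon>..\<alpha>1} \<subseteq> A \<union> B"
    using connectedD[of "{- \<epsilon>..\<alpha>1}" A B] by blast
  then obtain \<alpha> where \<alpha>: "\<alpha> \<le> \<alpha>1" and pn: "\<And>t. 0 \<le> t \<Longrightarrow> 0 \<le> p \<alpha> t"
    and Hn: "\<And>t. 0 \<le> t \<Longrightarrow> \<eta> (I \<alpha>) t \<le> 0"
    by (force simp: A_def B_def not_less)
  define f W H where "f = \<phi> (I \<alpha>)" and "W = \<omega> (I \<alpha>)" and "H = \<eta> (I \<alpha>)"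
  define \<pi> where "\<pi> t = W t - a / 2 * (f t)\<^sup>2" for t
  \<comment> \<open>Were \<bar>f\<bar> > K, the clipped square would be a K^2 / 2 > M >= W and the
    slope negative. So \<open>f\<close> is not clipped, and the slope lies in [0, M].\<close>
  have p\<pi>: "p \<alpha> t = \<pi> t \<and> P (\<pi> t) = \<pi> t" if t: "0 \<le> t" for t
  proof -
    have "W t \<le> W 0" by (rule halfline_ge[of W H]) (use d Hn t in \<open>auto simp: W_def H_def\<close>)
    then have WM: "W t \<le> M" using \<alpha> by (simp add: W_def init' M_def)
    have "\<bar>f t\<bar> \<le> K"
    proof (rule ccontr)
      assume "\<not> \<bar>f t\<bar> \<le> K"
      then have "max (- K) (min K (f t)) = K \<or> max (- K) (min K (f t)) = - K" using K by auto
      then have "q (f t) = a / 2 * K\<^sup>2" by (auto simp: q_def)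
      then show False using pn[OF t] WM aK by (simp add: p_def W_def f_def)
    qed
    then have "max (- K) (min K (f t)) = f t" by auto
    then have 1: "p \<alpha> t = \<pi> t" by (simp add: p_def q_def \<pi>_def W_def f_def)
    moreover have "p \<alpha> t \<le> W t" using a by (simp add: p_def q_def W_def)
    ultimately show ?thesis using pn[OF t] WM by (auto simp: P_def)
  qed
  define r where "r t = H t - a * f t * \<pi> t" for t
  have df: "(f has_real_derivative \<pi> t) (at t within {0..})"
    and dW: "(W has_real_derivative H t) (at t within {0..})"
    and dH: "(H has_real_derivative c * (\<pi> t)\<^sup>2) (at t within {0..})" if "0 \<le> t" for t
    using d[OF that, of "I \<alpha>"] p\<pi>[OF that] by (simp_all add: f_def W_def H_def flip: p_def)
  have d\<pi>: "(\<pi> has_real_derivative r t) (at t within {0..})" if "0 \<le> t" for t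
    unfolding \<pi>_def[abs_def]
    by (rule derivative_eq_intros df dW that refl)+ (simp add: r_def \<pi>_def)
  have "similarity_flow a b f \<pi> r"
  proof
    show "(r has_real_derivative b * (\<pi> t)\<^sup>2 - a * f t * r t) (at t within {0..})" if "0 \<le> t" for t
      unfolding r_def[abs_def]
      by (rule derivative_eq_intros df d\<pi> dH that refl)+
        (simp add: r_def c_def algebra_simps power2_eq_square)
    show "r 0 = - 1" by (simp add: r_def \<pi>_def f_def W_def H_def init')
  qed (use a b df d\<pi> in auto)
  moreover have "f 0 = - \<gamma>" by (simp add: f_def init')
  moreover have "0 \<le> \<pi> t \<and> r t + a * f t * \<pi> t \<le> 0" if "0 \<le> t" for t
    using pn[OF that] p\<pi>[OF that] Hn[OF that] by (simp add: r_def H_def)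
  ultimately show ?thesis by blast
qed

section \<open>The boundary value problem\<close>

text \<open>The one-sided derivative is unique also at 0, because right neighbourhoods of
  \<open>t\<close> keep the filter nontrivial.\<close>

lemma hderiv_eq:
  assumes "(f has_real_derivative d) (at t within {0..})" "0 \<le> t"
  shows "hderiv f t = d"
proof -
  have "at t within {t<..} \<le> at t within {0..}" using assms(2) by (intro at_le) auto
  then have "at t within {0..} \<noteq> bot" by (metis bot.extremum_uniqueI trivial_limit_at_right_real)
  then show ?thesis unfolding hderiv_def
    using assms(1) by (simp add: vector_derivative_within has_real_derivative_iff_has_vector_derivative)
qed

lemma has_derivative_hderiv:
  assumes "f differentiable_on {0..}" "0 \<le> t"
  shows "(f has_real_derivative hderiv f t) (at t within {0..})"
  using assms by (simp add: hderiv_def differentiable_on_def vector_derivative_works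
      has_real_derivative_iff_has_vector_derivative)

lemma halfline_derivative_transform:
  assumes "(g has_real_derivative d) (at t within {0..})" "0 \<le> t" "\<And>x. 0 \<le> x \<Longrightarrow> f x = g x"
  shows "(f has_real_derivative d) (at t within {0..})"
  using has_vector_derivative_transform[of t "{0..}" f g d] assms
  by (simp add: has_real_derivative_iff_has_vector_derivative)

section \<open>Translation between flows and concave solutions\<close>

context similarity_flow
begin

lemma hderiv_f: "0 \<le> t \<Longrightarrow> hderiv f t = p t"
  by (rule hderiv_eq[OF df])

lemma hderiv2_f:
  assumes "0 \<le> t"
  shows "hderiv (hderiv f) t = r t"
  by (rule hderiv_eq[OF halfline_derivative_transform[OF dp]]) (use assms hderiv_f in auto)

lemma hderiv3_f:
  assumes "0 \<le> t"
  shows "(hderiv (hderiv f) has_real_derivative b * (p t)\<^sup>2 - a * f t * r t) (at t within {0..})"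
  by (rule halfline_derivative_transform[OF dr]) (use assms hderiv2_f in auto)

lemma three_times_differentiable: "three_times_differentiable f"
proof -
  have "(hderiv f has_real_derivative r t) (at t within {0..})" if "0 \<le> t" for t
    by (rule halfline_derivative_transform[OF dp]) (use that hderiv_f in auto)
  then show ?thesis
    unfolding three_times_differentiable_def differentiable_on_def
    using df hderiv3_f by (metis atLeast_iff real_differentiable_def)
qed

text \<open>The graph lies below every tangent; averaging the tangent bound taken at the convex
  combination cancels the linear terms.\<close>

lemma concave_if_r_nonpos:
  assumes rn: "\<And>t. 0 \<le> t \<Longrightarrow> r t \<le> 0"
  shows "concave_on {0..} f"
proof -
  have tangent: "f x \<le> f c + p c * (x - c)" if "0 \<le> x" "0 \<le> c" for x c
  proof (cases "c \<le> x")
    case True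
    then show ?thesis
      by (intro halfline_growth_le[OF df]) (use that p_antimono[OF rn] in auto)
  next
    case False
    then have "f x + p c * (c - x) \<le> f c"
      by (intro halfline_growth_ge[OF df]) (use that p_antimono[OF rn] in auto)
    then show ?thesis by (simp add: algebra_simps)
  qed
  show ?thesis
    unfolding concave_on_iff
  proof (intro conjI ballI allI impI)
    fix x y u v :: real
    assume *: "x \<in> {0..}" "y \<in> {0..}" "0 \<le> u" "0 \<le> v" "u + v = 1"
    define c where "c = u * x + v * y"
    have c: "0 \<le> c" using * by (simp add: c_def)
    have "u * f x + v * f y \<le> u * (f c + p c * (x - c)) + v * (f c + p c * (y - c))"
      using * c by (intro add_mono mult_left_mono tangent) auto
    also have "\<dots> = (u + v) * f c + p c * (u * x + v * y - (u + v) * c)" by (simp add: algebra_simps)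
    also have "\<dots> = f c" using * by (simp add: c_def)
    finally show "u * f x + v * f y \<le> f (u *\<^sub>R x + v *\<^sub>R y)" by (simp add: c_def)
  qed simp
qed

lemma r_nonpos_if_concave:
  assumes conc: "concave_on {0..} f" and t: "0 \<le> t"
  shows "r t \<le> 0"
proof (rule ccontr)
  assume "\<not> r t \<le> 0"
  then have rp: "0 < r x" if "t \<le> x" for x using r_pos_persists[of t x] t that by auto
  have p_less: "p x < p y" if "t \<le> x" "x < y" for x y
    by (rule halfline_less[OF dp]) (use rp that t in auto)
  \<comment> \<open>Splitting [t, t + 1] at its midpoint makes the increment of \<open>f\<close>
    there strictly less than \<open>p (t + 1)\<close>, hence less than the increment over
    [t + 1, t + 2]. This contradicts midpoint concavity.\<close>
  have "f (t + 1/2) \<le> f t + p (t + 1/2) * (t + 1/2 - t)"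
    by (rule halfline_growth_le[OF df]) (use p_less t in \<open>auto intro: less_imp_le\<close>)
  moreover have "f (t + 1) \<le> f (t + 1/2) + p (t + 1) * (t + 1 - (t + 1/2))"
    by (rule halfline_growth_le[OF df]) (use p_less t in \<open>auto intro: less_imp_le\<close>)
  moreover have "f (t + 1) + p (t + 1) * (t + 2 - (t + 1)) \<le> f (t + 2)"
    by (rule halfline_growth_ge[OF df]) (use p_less t in \<open>auto intro: less_imp_le\<close>)
  moreover have "p (t + 1/2) < p (t + 1)" by (rule p_less) auto
  moreover have "f t + f (t + 2) \<le> 2 * f (t + 1)"
  proof -
    have *: "\<forall>x\<in>{0..}. \<forall>y\<in>{0..}. \<forall>u\<ge>0. \<forall>v\<ge>0. u + v = 1 \<longrightarrow>
        u * f x + v * f y \<le> f (u *\<^sub>R x + v *\<^sub>R y)"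
      using conc by (simp add: concave_on_iff)
    have "1/2 * f t + 1/2 * f (t + 2) \<le> f ((1/2) *\<^sub>R t + (1/2) *\<^sub>R (t + 2))"
      by (rule *[rule_format]) (use t in auto)
    moreover have "(1/2) *\<^sub>R t + (1/2) *\<^sub>R (t + 2) = t + 1" by (simp add: field_simps)
    ultimately show ?thesis by (simp only:)
  qed
  ultimately show False by simp
qed

lemma p_nonneg_if_tendsto_0:
  assumes rn: "\<And>t. 0 \<le> t \<Longrightarrow> r t \<le> 0" and lim: "(p \<longlongrightarrow> 0) at_top" and s: "0 \<le> s"
  shows "0 \<le> p s"
proof (rule ccontr)
  assume "\<not> 0 \<le> p s"
  then have "\<forall>\<^sub>F t in at_top. p s < p t \<and> s \<le> t"
    using order_tendstoD(1)[OF lim, of "p s"] eventually_ge_at_top[of s] by (auto intro: eventually_conj)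
  then obtain t where "p s < p t" "s \<le> t" using eventually_happens by fastforce
  then show False using p_antimono[OF rn s, of t] by auto
qed

end

text \<open>A positive initial gap could not shrink, yet both slopes tend to 0. Used in both
  directions, this gives equal initial slopes.\<close>

lemma initial_slope_le:
  assumes F: "similarity_flow a b f p r" and G: "similarity_flow a b g q s"
    and rn: "\<And>t. 0 \<le> t \<Longrightarrow> r t \<le> 0" and sn: "\<And>t. 0 \<le> t \<Longrightarrow> s t \<le> 0"
    and pl: "(p \<longlongrightarrow> 0) at_top" and ql: "(q \<longlongrightarrow> 0) at_top"
    and init: "f 0 = g 0"
  shows "p 0 \<le> q 0"
proof (rule ccontr)
  assume n: "\<not> p 0 \<le> q 0"
  have "((\<lambda>t. p t - q t) \<longlongrightarrow> 0) at_top" using tendsto_diff[OF pl ql] by simp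
  then have "\<forall>\<^sub>F t in at_top. p t - q t < p 0 - q 0 \<and> 0 \<le> t"
    using n by (intro eventually_conj order_tendstoD(2) eventually_ge_at_top) auto
  then obtain t where t: "p t - q t < p 0 - q 0" "0 \<le> t" using eventually_happens by fastforce
  moreover have "p 0 - q 0 \<le> p t - q t"
    by (rule slope_gap_persists[OF F G])
      (use similarity_flow.p_nonneg_if_tendsto_0[OF F rn pl] similarity_flow.p_nonneg_if_tendsto_0[OF G sn ql]
        sn init n t in auto)
  ultimately show False by simp
qed

lemma bvp_solution_flow:
  assumes "bvp_solution m \<gamma> g" "- 1 / 2 \<le> m"
  shows "similarity_flow (m + 2) (2 * m + 1) g (hderiv g) (hderiv (hderiv g))"
proof
  fix t :: real assume t: "0 \<le> t"
  have "hderiv (hderiv (hderiv g)) t = (2 * m + 1) * (hderiv g t)\<^sup>2 - (m + 2) * g t * hderiv (hderiv g) t"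
    using assms t by (auto simp: bvp_solution_def algebra_simps)
  then show "(hderiv (hderiv g) has_real_derivative
      (2 * m + 1) * (hderiv g t)\<^sup>2 - (m + 2) * g t * hderiv (hderiv g) t) (at t within {0..})"
    using assms t by (metis bvp_solution_def three_times_differentiable_def has_derivative_hderiv)
qed (use assms in \<open>auto simp: bvp_solution_def three_times_differentiable_def intro: has_derivative_hderiv\<close>)

theorem theorem3p6:
  fixes \<gamma> m :: real
  assumes "m \<ge> - 1 / 2"
  shows "\<exists>f :: real \<Rightarrow> real.
           bvp_solution m \<gamma> f \<and> concave_on {0..} f \<and>
           (\<forall>g. bvp_solution m \<gamma> g \<and> concave_on {0..} g \<longrightarrow> (\<forall>t\<ge>0. g t = f t)) \<and>
           (\<forall>\<^sub>F t in at_top. f t > 0) \<and>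
           (\<forall>t\<ge>0. - \<gamma> \<le> f t \<and> f t \<le> sqrt (\<gamma>\<^sup>2 + 2 * (hderiv f 0 / (m + 2))))"
proof -
  have ab: "0 < m + 2" "0 \<le> 2 * m + 1" using assms by auto
  obtain f p r where F: "similarity_flow (m + 2) (2 * m + 1) f p r" and f0: "f 0 = - \<gamma>"
    and p: "\<And>t. 0 \<le> t \<Longrightarrow> 0 \<le> p t" and H0: "\<And>t. 0 \<le> t \<Longrightarrow> r t + (m + 2) * f t * p t \<le> 0"
    using monotone_flow_exists[OF ab, of \<gamma>] by blast
  interpret similarity_flow "m + 2" "2 * m + 1" f p r by (rule F)
  have Hn: "H t \<le> 0" if "0 \<le> t" for t using H0[OF that] by (simp add: H_def)
  note rn = concave_if_H_nonpos[OF p Hn]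
  note lim = p_tendsto_0[OF p Hn]
  have hlim: "(hderiv f \<longlongrightarrow> 0) at_top"
  proof (rule Lim_transform_eventually[OF lim])
    show "\<forall>\<^sub>F t in at_top. p t = hderiv f t"
      using eventually_ge_at_top[of 0] by eventually_elim (simp add: hderiv_f)
  qed
  show ?thesis
  proof (intro exI[of _ f] conjI allI impI)
    show "bvp_solution m \<gamma> f"
      unfolding bvp_solution_def
    proof (intro conjI allI impI three_times_differentiable hlim f0)
      show "hderiv (hderiv f) 0 = - 1" by (simp add: hderiv2_f r0)
      fix t :: real assume t: "0 \<le> t"
      show "hderiv (hderiv (hderiv f)) t + (m + 2) * f t * hderiv (hderiv f) t
          - (2 * m + 1) * (hderiv f t)\<^sup>2 = 0"
        using hderiv_eq[OF hderiv3_f[OF t] t] t by (simp add: hderiv_f hderiv2_f)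
    qed
    show "concave_on {0..} f" by (rule concave_if_r_nonpos[OF rn])
    show "\<forall>\<^sub>F t in at_top. 0 < f t"
      by (rule eventually_positive[OF p rn lim]) simp_all
  next
    fix g t assume "bvp_solution m \<gamma> g \<and> concave_on {0..} g" and t: "(0::real) \<le> t"
    then have g: "bvp_solution m \<gamma> g" and conc: "concave_on {0..} g" by auto
    note G = bvp_solution_flow[OF g assms]
    note sn = similarity_flow.r_nonpos_if_concave[OF G conc]
    have glim: "(hderiv g \<longlongrightarrow> 0) at_top" and g0: "g 0 = f 0"
      using g f0 by (auto simp: bvp_solution_def)
    have "hderiv g 0 = p 0"
      using initial_slope_le[OF F G rn sn lim glim g0[symmetric]]
        initial_slope_le[OF G F sn rn glim lim g0] by simp
    then show "g t = f t" by (rule initial_value_unique[OF G F g0 _ t])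
  next
    fix t :: real assume t: "0 \<le> t"
    show "- \<gamma> \<le> f t" using halfline_le[OF df, of 0 t] p t f0 by simp
    show "f t \<le> sqrt (\<gamma>\<^sup>2 + 2 * (hderiv f 0 / (m + 2)))"
      using f_bound[OF Hn t p[OF t]] by (simp add: f0 hderiv_f)
  qed
qed

end
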